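(* There exists an absolute constant $a_3\le 20369$ such that for all natural numbers $n_1,n_2,n_3$ with $1<n_1\mid n_2\mid n_3$, $$D(C_{n_1}\oplus C_{n_2}\oplus C_{n_3})\le (n_1-1)+(n_2-1)+(n_3-1)+1+(a_3-3)(n_1-1).$$
   Context: $C_n$ denotes the cyclic group of order $n$, written additively. For a finite abelian group $G$, a sequence over $G$ is a finite sequence of elements of $G$ in which repetitions are allowed and order is disregarded (a finite multiset of elements of $G$); its length is the number of its terms counted with multiplicity. A subsequence is a sub-multiset, and it is zero-sum if the sum of its terms (with multiplicity) is $0$. The Davenport constant $D(G)$ is the smallest natural number $t$ such that every sequence over $G$ of length at least $t$ has a non-empty zero-sum subsequence. *)

theory Defs
  imports Complex_Main "HOL-Library.Multiset" "HOL-Algebra.FiniteProduct" "HOL-Algebra.Elementary_Groups"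
begin

(* Sequences over G are multisets S with set_mset S \<subseteq> carrier G. Groups are in the
   multiplicative notation of HOL-Algebra, so the "sum" of S is the product of
   g [^] (multiplicity of g in S) over the distinct terms g of S. *)
definition seq_sum :: "('a, 'b) monoid_scheme \<Rightarrow> 'a multiset \<Rightarrow> 'a" where
  "seq_sum G S = (\<Otimes>\<^bsub>G\<^esub> g \<in> set_mset S. g [^]\<^bsub>G\<^esub> count S g)"

definition zero_sum :: "('a, 'b) monoid_scheme \<Rightarrow> 'a multiset \<Rightarrow> bool" where
  "zero_sum G S \<longleftrightarrow> seq_sum G S = \<one>\<^bsub>G\<^esub>"

(* Meaningful for finite abelian G, where some t with the required property exists. *)
definition davenport :: "('a, 'b) monoid_scheme \<Rightarrow> nat" where
  "davenport G = (LEAST t. \<forall>S. set_mset S \<subseteq> carrier G \<and> t \<le> size S \<longrightarrow>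
     (\<exists>T. T \<subseteq># S \<and> T \<noteq> {#} \<and> zero_sum G T))"

end

theory Submission
  imports Defs "HOL-Number_Theory.Residues" "HOL-Library.Disjoint_Sets" "HOL-Library.Product_Plus"
begin

text \<open>
  Let \<open>\<eta>(C\<^sub>n\<^sup>d)\<close> be the least number such that any \<open>\<eta>(C\<^sub>n\<^sup>d)\<close> elements of \<open>C\<^sub>n\<^sup>d\<close> contain a
  \<^emph>\<open>short\<close> zero sum, that is, a non-empty one of length at most \<open>n\<close>. The theorem follows from the
  linear bound \<open>\<eta>(C\<^sub>n\<^sup>3) \<le> 20369 (n - 1) + 1\<close> (lemma \<open>short_zero_sum_rank_three\<close>). Indeed, reduction
  modulo \<open>n\<^sub>1\<close> maps \<open>C\<^sub>n\<^sub>1 \<oplus> C\<^sub>n\<^sub>2 \<oplus> C\<^sub>n\<^sub>3\<close> onto \<open>C\<^sub>n\<^sub>1\<^sup>3\<close>, and the kernel has rank two with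
  Davenport constant \<open>n\<^sub>2 / n\<^sub>1 + n\<^sub>3 / n\<^sub>1 - 1\<close> by Olson's theorem (\<open>zero_sum_rank_two\<close>). A sequence of
  length \<open>20369 (n\<^sub>1 - 1) + 1 + n\<^sub>2 + n\<^sub>3 - 2 n\<^sub>1\<close> contains that many disjoint subsequences, each of
  length at most \<open>n\<^sub>1\<close> and with its sum in the kernel, and some of these sums add up to zero
  (\<open>zero_sum_rank_three\<close>).

  Bounds of the form \<open>\<eta>(C\<^sub>n\<^sup>d) \<le> c (n - 1) + 1\<close> are multiplicative in \<open>n\<close>, so it suffices to treat a
  prime \<open>p\<close>. In dimension two, the polynomial method on the Boolean cube gives \<open>\<eta>(C\<^sub>p\<^sup>2) \<le> 3p - 2\<close>
  and zero sums of length exactly \<open>p\<close> among \<open>4p - 2\<close> elements. In dimension three there are two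
  cases. If \<open>p \<le> 6788\<close>, the \<open>p + 1\<close> planes through a line cover the space, and the bound for a
  plane gives \<open>\<eta>(C\<^sub>p\<^sup>3) \<le> 3 (p + 1) (p - 1) + 1\<close>, which is good enough.

  If \<open>p > 6788\<close>, the idea of Alon and Dubiner applies. In a sequence without a short zero sum no
  affine plane contains more than \<open>4p\<close> terms. Choose terms one by one so that the set of their
  subset sums grows fast. At first, one of three independent terms enlarges a set of size \<open>b\<close> by a
  constant times \<open>b\<^sup>2\<^sup>/\<^sup>3\<close>, so that \<open>p / 4\<close> terms yield a fixed proportion of the group
  (\<open>subset_sums_cubic_growth\<close>). From then on, Fourier analysis shows that among terms spread over the
  planes there is always one that enlarges the set by a factor of \<open>1 + 100 / p\<close>
  (\<open>plane_sparse_expansion\<close>), and another \<open>p / 4\<close> terms fill more than half of the group. Doing this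
  twice with disjoint sets of terms, every group element is a sum of at most \<open>p - 1\<close> different
  terms; applied to the negative of an unused term, this is a short zero sum, a contradiction.
\<close>

section \<open>Low-degree functions on the subsets of a set\<close>

text \<open>
  A subset \<open>I\<close> stands for its 0-1 indicator vector \<open>x\<close>, on which the monomial
  \<open>\<Prod>i\<in>T. x\<^sub>i\<close> takes the value \<open>of_bool (T \<subseteq> I)\<close>. So these are the functions on the
  Boolean cube given by integer polynomials of degree at most \<open>d\<close>. Every such polynomial agrees on
  the cube with a multilinear one, which is why square-free monomials suffice.
\<close>
inductive cube_poly :: "nat \<Rightarrow> (nat set \<Rightarrow> int) \<Rightarrow> bool" for d where
  monomial: "finite T \<Longrightarrow> card T \<le> d \<Longrightarrow> cube_poly d (\<lambda>I. of_bool (T \<subseteq> I))"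
| add: "cube_poly d f \<Longrightarrow> cube_poly d g \<Longrightarrow> cube_poly d (\<lambda>I. f I + g I)"
| scale: "cube_poly d f \<Longrightarrow> cube_poly d (\<lambda>I. c * f I)"

lemma cube_poly_const: "cube_poly d (\<lambda>I. c)"
  using cube_poly.scale[OF cube_poly.monomial[of "{}" d], of c] by simp

lemma cube_poly_diff:
  assumes "cube_poly d f" "cube_poly d g"
  shows "cube_poly d (\<lambda>I. f I - g I)"
  using cube_poly.add[OF assms(1) cube_poly.scale[OF assms(2), of "-1"]] by simp

lemma cube_poly_sum:
  assumes "\<And>i. i \<in> A \<Longrightarrow> cube_poly d (f i)"
  shows "cube_poly d (\<lambda>I. \<Sum>i\<in>A. f i I)"
  using assms
proof (induction A rule: infinite_finite_induct)
  case (insert x F)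
  then show ?case
    using cube_poly.add[of d "f x" "\<lambda>I. \<Sum>i\<in>F. f i I"] by simp
qed (auto simp: cube_poly_const)

text \<open>
  The product of the monomials of \<open>T\<close> and \<open>U\<close> is, on the cube, the monomial of \<open>T \<union> U\<close>.
\<close>
lemma cube_poly_mult:
  assumes "cube_poly d f" "cube_poly e g"
  shows "cube_poly (d + e) (\<lambda>I. f I * g I)"
  using assms(1)
proof (induction rule: cube_poly.induct)
  case (monomial T)
  show ?case
    using assms(2)
  proof (induction rule: cube_poly.induct)
    case (monomial U)
    have "card (T \<union> U) \<le> d + e"
      using card_Un_le[of T U] monomial \<open>card T \<le> d\<close> by linarith
    then have "cube_poly (d + e) (\<lambda>I. of_bool (T \<union> U \<subseteq> I))"
      using monomial \<open>finite T\<close> by (intro cube_poly.monomial) auto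
    also have "(\<lambda>I. of_bool (T \<union> U \<subseteq> I)) = (\<lambda>I. of_bool (T \<subseteq> I) * of_bool (U \<subseteq> I) :: int)"
      by (auto simp: fun_eq_iff)
    finally show ?case .
  next
    case (add f g)
    then show ?case
      using cube_poly.add[of "d + e"] by (simp add: distrib_left)
  next
    case (scale f c)
    then show ?case
      using cube_poly.scale[of "d + e" _ c] by (simp add: mult.left_commute)
  qed
next
  case (add f g)
  then show ?case
    using cube_poly.add[of "d + e"] by (simp add: distrib_right)
next
  case (scale f c)
  then show ?case
    using cube_poly.scale[of "d + e" _ c] by (simp add: mult.assoc)
qed

lemma cube_poly_power:
  assumes "cube_poly d f"
  shows "cube_poly (k * d) (\<lambda>I. f I ^ k)"
proof (induction k)
  case (Suc k)
  then show ?case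
    using cube_poly_mult[OF assms Suc] by simp
qed (simp add: cube_poly_const)

lemma cube_poly_prod:
  assumes "finite J" "\<And>j. j \<in> J \<Longrightarrow> cube_poly e (f j)"
  shows "cube_poly (card J * e) (\<lambda>I. \<Prod>j\<in>J. f j I)"
  using assms
proof (induction J rule: finite_induct)
  case (insert x F)
  then show ?case
    using cube_poly_mult[of e "f x" "card F * e" "\<lambda>I. \<Prod>j\<in>F. f j I"] by simp
qed (simp add: cube_poly_const)

text \<open>
  A monomial of degree less than \<open>card M\<close> misses some variable \<open>i \<in> M\<close>. Adding or removing \<open>i\<close>
  does not change its value but changes the parity of the subset, so the terms cancel in pairs.
\<close>
lemma cube_poly_alternating_sum:
  assumes "cube_poly d f" "finite M" "d < card M"
  shows "(\<Sum>I\<in>Pow M. (-1) ^ card I * f I) = 0"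
  using assms(1)
proof (induction rule: cube_poly.induct)
  case (monomial T)
  then have "\<not> M \<subseteq> T"
    using card_mono[of T M] assms(3) by linarith
  then obtain i where i: "i \<in> M" "i \<notin> T"
    by blast
  define N where "N = M - {i}"
  have N: "finite N" "i \<notin> N" "M = insert i N"
    using i assms(2) by (auto simp: N_def)
  have inj: "inj_on (insert i) (Pow N)"
    using N by (auto simp: inj_on_def)
  have "(\<Sum>I\<in>insert i ` Pow N. (-1) ^ card I * of_bool (T \<subseteq> I))
      = (\<Sum>I\<in>Pow N. - ((-1) ^ card I * of_bool (T \<subseteq> I)) :: int)"
    unfolding sum.reindex[OF inj]
  proof (rule sum.cong, simp)
    fix I assume "I \<in> Pow N"
    then have "finite I" "i \<notin> I"
      using N finite_subset by auto
    then show "((\<lambda>I. (-1) ^ card I * of_bool (T \<subseteq> I)) \<circ> insert i) I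
        = - ((-1) ^ card I * of_bool (T \<subseteq> I) :: int)"
      using i by (auto simp: subset_insert)
  qed
  moreover have "Pow N \<inter> insert i ` Pow N = {}"
    using N by auto
  ultimately show ?case
    using N(1) unfolding N(3) Pow_insert
    by (subst sum.union_disjoint) (simp_all add: sum_negf)
next
  case (add f g)
  then show ?case
    by (simp add: distrib_left sum.distrib)
next
  case (scale f c)
  then show ?case
    by (simp add: mult.left_commute[of _ c] flip: sum_distrib_left)
qed

text \<open>
  The form in which the polynomial method is applied. To show that some non-empty subset is good, one
  takes a low-degree function that vanishes modulo \<open>q\<close> at every bad non-empty subset and not at the
  empty set.
\<close>
lemma cube_poly_dvd_at_empty:
  fixes q :: int
  assumes "cube_poly d f" "finite M" "d < card M"
    and "\<And>I. I \<subseteq> M \<Longrightarrow> I \<noteq> {} \<Longrightarrow> q dvd f I"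
  shows "q dvd f {}"
proof -
  have "(\<Sum>I\<in>Pow M. (-1) ^ card I * f I) = f {} + (\<Sum>I\<in>Pow M - {{}}. (-1) ^ card I * f I)"
    using assms(2) by (subst sum.remove[of _ "{}"]) auto
  moreover have "q dvd (\<Sum>I\<in>Pow M - {{}}. (-1) ^ card I * f I)"
    using assms(4) by (intro dvd_sum dvd_mult) auto
  ultimately show ?thesis
    using cube_poly_alternating_sum[OF assms(1-3)] by (metis dvd_0_right dvd_add_left_iff)
qed

section \<open>Zero sums modulo a prime\<close>

definition linear_form :: "nat set \<Rightarrow> (nat \<Rightarrow> int) \<Rightarrow> nat set \<Rightarrow> int" where
  "linear_form M a I = (\<Sum>i\<in>M. a i * of_bool ({i} \<subseteq> I))"

lemma cube_poly_linear_form: "cube_poly 1 (linear_form M a)"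
  unfolding linear_form_def
  by (intro cube_poly_sum cube_poly.scale cube_poly.monomial) auto

lemma linear_form_eq:
  assumes "finite M" "I \<subseteq> M"
  shows "linear_form M a I = (\<Sum>i\<in>I. a i)"
  unfolding linear_form_def
  by (rule sum.mono_neutral_cong_right) (use assms in auto)

text \<open>
  By Fermat's little theorem this is, modulo \<open>p\<close>, the indicator of \<open>p\<close> dividing the sum over \<open>I\<close>.
\<close>
definition vanishing_test :: "nat \<Rightarrow> nat set \<Rightarrow> (nat \<Rightarrow> int) \<Rightarrow> nat set \<Rightarrow> int" where
  "vanishing_test p M a I = 1 - linear_form M a I ^ (p - 1)"

lemma cube_poly_vanishing_test: "cube_poly (p - 1) (vanishing_test p M a)"
  using cube_poly_diff[OF cube_poly_const cube_poly_power[OF cube_poly_linear_form], of "p - 1"]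
  by (simp add: vanishing_test_def[abs_def])

lemma vanishing_test_empty: "prime p \<Longrightarrow> vanishing_test p M a {} = 1"
  using prime_gt_1_nat[of p] by (simp add: vanishing_test_def linear_form_def)

lemma dvd_vanishing_test:
  assumes "prime p" "finite M" "I \<subseteq> M" "\<not> int p dvd (\<Sum>i\<in>I. a i)"
  shows "int p dvd vanishing_test p M a I"
proof -
  define s where "s = (\<Sum>i\<in>I. a i)"
  define t where "t = nat (s mod int p)"
  have p: "p > 1"
    using prime_gt_1_nat assms(1) by blast
  have st: "[s = int t] (mod int p)"
    using p by (simp add: t_def cong_def)
  then have "\<not> p dvd t"
    using assms(4) unfolding s_def[symmetric] by (metis cong_dvd_iff int_dvd_int_iff)
  then have "[t ^ (p - 1) = 1] (mod p)"
    using fermat_theorem assms(1) by blast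
  then have "[int t ^ (p - 1) = 1] (mod int p)"
    by (metis cong_int_iff of_nat_1 of_nat_power)
  then have "[s ^ (p - 1) = 1] (mod int p)"
    using cong_pow[OF st, of "p - 1"] cong_trans by blast
  then have "int p dvd 1 - s ^ (p - 1)"
    by (metis cong_iff_dvd_diff cong_sym)
  then show ?thesis
    using assms by (simp add: vanishing_test_def linear_form_eq s_def)
qed

lemma dvd_prod_factor:
  fixes f :: "'a \<Rightarrow> int"
  assumes "finite J" "j \<in> J" "q dvd f j"
  shows "q dvd prod f J"
  by (rule dvd_trans[OF assms(3)]) (rule dvd_prodI[OF assms(1,2)])

text \<open>
  Olson's bound \<open>d (p - 1) + 1\<close> for the Davenport constant of \<open>C\<^sub>p\<^sup>d\<close>: the product of the tests for
  the \<open>d\<close> coordinates has degree \<open>d (p - 1)\<close>, equals \<open>1\<close> at the empty set, and vanishes at all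
  subsets whose sum is not zero.
\<close>
lemma zero_sum_elementary:
  fixes a :: "nat \<Rightarrow> nat \<Rightarrow> int"
  assumes "prime p" "finite M" "d * (p - 1) < card M"
  shows "\<exists>I\<subseteq>M. I \<noteq> {} \<and> (\<forall>j<d. int p dvd (\<Sum>i\<in>I. a i j))"
proof (rule ccontr)
  assume contra: "\<not> ?thesis"
  define f where "f I = (\<Prod>j<d. vanishing_test p M (\<lambda>i. a i j) I)" for I
  have "cube_poly (d * (p - 1)) f"
    unfolding f_def
    using cube_poly_prod[of "{..<d}" "p - 1" "\<lambda>j. vanishing_test p M (\<lambda>i. a i j)",
        OF _ cube_poly_vanishing_test] by simp
  then have "int p dvd f {}"
  proof (rule cube_poly_dvd_at_empty[OF _ assms(2,3)])
    fix I assume I: "I \<subseteq> M" "I \<noteq> {}"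
    then obtain j where "j < d" "\<not> int p dvd (\<Sum>i\<in>I. a i j)"
      using contra by blast
    then show "int p dvd f I"
      using dvd_prod_factor[of "{..<d}" j "int p" "\<lambda>j. vanishing_test p M (\<lambda>i. a i j) I"]
        dvd_vanishing_test[OF assms(1,2) I(1)] by (simp add: f_def)
  qed
  then show False
    using assms(1) prime_gt_1_nat[of p] by (simp add: f_def vanishing_test_empty)
qed

text \<open>
  Among any \<open>L\<close> vectors of \<open>C\<^sub>n\<^sup>d\<close> there is a non-empty zero-sum subsequence of length at most \<open>n\<close>;
  the least such \<open>L\<close> is usually called \<open>\<eta>(C\<^sub>n\<^sup>d)\<close>. Sequences are indexed families of integer vectors,
  and only the values modulo \<open>n\<close> matter. Keeping integers makes it possible to divide a zero sum
  by \<open>n\<close> later.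
\<close>
definition short_zero_sum_bound :: "nat \<Rightarrow> nat \<Rightarrow> nat \<Rightarrow> bool" where
  "short_zero_sum_bound d n L \<longleftrightarrow>
     (\<forall>M (a :: nat \<Rightarrow> nat \<Rightarrow> int). finite M \<and> L \<le> card M \<longrightarrow>
       (\<exists>I\<subseteq>M. I \<noteq> {} \<and> card I \<le> n \<and> (\<forall>j<d. int n dvd (\<Sum>i\<in>I. a i j))))"

lemma short_zero_sum_boundD:
  fixes a :: "nat \<Rightarrow> nat \<Rightarrow> int"
  assumes "short_zero_sum_bound d n L" "finite M" "L \<le> card M"
  obtains I where "I \<subseteq> M" "I \<noteq> {}" "card I \<le> n" "\<And>j. j < d \<Longrightarrow> int n dvd (\<Sum>i\<in>I. a i j)"
proof -
  have "\<exists>I\<subseteq>M. I \<noteq> {} \<and> card I \<le> n \<and> (\<forall>j<d. int n dvd (\<Sum>i\<in>I. a i j))"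
    using assms unfolding short_zero_sum_bound_def by blast
  then show thesis
    using that by blast
qed

lemma dvd_sum_complement:
  fixes a :: "nat \<Rightarrow> int"
  assumes "finite I" "T \<subseteq> I" "q dvd (\<Sum>i\<in>I. a i)" "q dvd (\<Sum>i\<in>T. a i)"
  shows "q dvd (\<Sum>i\<in>I - T. a i)"
  using assms by (simp add: sum_diff)

text \<open>
  An extra coordinate that is constantly \<open>1\<close> sums up to the length.
\<close>
lemma zero_sum_length_dvd:
  fixes a :: "nat \<Rightarrow> nat \<Rightarrow> int"
  assumes "prime p" "finite M" "(d + 1) * (p - 1) < card M"
  shows "\<exists>I\<subseteq>M. I \<noteq> {} \<and> p dvd card I \<and> (\<forall>j<d. int p dvd (\<Sum>i\<in>I. a i j))"
proof -
  obtain I where I: "I \<subseteq> M" "I \<noteq> {}"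
      "\<forall>j<d + 1. int p dvd (\<Sum>i\<in>I. (if j < d then a i j else 1))"
    using zero_sum_elementary[OF assms(1,2), of "d + 1" "\<lambda>i j. if j < d then a i j else 1"]
      assms(3) by auto
  have "p dvd card I"
    using I(3)[rule_format, of d] by simp
  moreover have "int p dvd (\<Sum>i\<in>I. a i j)" if "j < d" for j
    using I(3)[rule_format, of j] that by simp
  ultimately show ?thesis
    using I by blast
qed

text \<open>
  Among \<open>3p - 2\<close> vectors of the plane there is a zero sum of length \<open>p\<close> or \<open>2p\<close>. One of length \<open>2p\<close>
  has, by Olson's bound, a proper zero-sum part; this part or its complement has length at most \<open>p\<close>.
\<close>
lemma short_zero_sum_plane:
  assumes "prime p"
  shows "short_zero_sum_bound 2 p (3 * (p - 1) + 1)"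
  unfolding short_zero_sum_bound_def
proof (intro allI impI, elim conjE)
  fix M :: "nat set" and a :: "nat \<Rightarrow> nat \<Rightarrow> int"
  assume M: "finite M" "3 * (p - 1) + 1 \<le> card M"
  have p: "p > 1"
    using prime_gt_1_nat assms by blast
  obtain M' where M': "M' \<subseteq> M" "card M' = 3 * (p - 1) + 1"
    using obtain_subset_with_card_n[OF M(2)] by metis
  have "finite M'" "(2 + 1) * (p - 1) < card M'"
    using M' M finite_subset p by auto
  then obtain I where I: "I \<subseteq> M'" "I \<noteq> {}" "p dvd card I" "\<forall>j<2. int p dvd (\<Sum>i\<in>I. a i j)"
    using zero_sum_length_dvd[OF assms(1), of M' 2 a] by blast
  have fin: "finite I"
    using I M' M finite_subset by metis
  have "card I \<le> 3 * (p - 1) + 1"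
    using I M' M card_mono[of M' I] finite_subset by metis
  moreover obtain c where c: "card I = p * c"
    using I(3) by blast
  moreover have "3 * (p - 1) + 1 < p * 3"
    using p by simp
  ultimately have "p * c < p * 3"
    by linarith
  then have "c < 3"
    by simp
  moreover have "c \<noteq> 0"
    using c I fin by auto
  ultimately consider "c = 1" | "c = 2"
    by linarith
  then show "\<exists>I\<subseteq>M. I \<noteq> {} \<and> card I \<le> p \<and> (\<forall>j<2. int p dvd (\<Sum>i\<in>I. a i j))"
  proof cases
    case 1
    then show ?thesis
      using I M' c by (intro exI[of _ I]) auto
  next
    case 2
    (* A part found after omitting one term cannot be all of I, so its complement is non-empty. *)
    have "2 * p - 1 \<le> card I"
      using 2 c by simp
    then obtain I' where I': "I' \<subseteq> I" "card I' = 2 * p - 1"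
      by (metis obtain_subset_with_card_n)
    have "finite I'" "2 * (p - 1) < card I'"
      using I' fin finite_subset p by auto
    then obtain T where T: "T \<subseteq> I'" "T \<noteq> {}" "\<forall>j<2. int p dvd (\<Sum>i\<in>T. a i j)"
      using zero_sum_elementary[OF assms, of I' 2 a] by blast
    have fT: "finite T"
      using T I' fin finite_subset by metis
    have TI: "T \<subseteq> I"
      using T I' by auto
    have card_T: "card T \<le> 2 * p - 1"
      using T I' fin card_mono[of I' T] finite_subset by metis
    have card_diff: "card (I - T) = 2 * p - card T"
      using card_Diff_subset[OF fT TI] 2 c by simp
    show ?thesis
    proof (cases "card T \<le> p")
      case True
      then show ?thesis
        using T TI I M' by (intro exI[of _ T]) auto
    next
      case False
      have "card (I - T) > 0"
        using card_diff card_T p by linarith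
      then have "I - T \<noteq> {}"
        by fastforce
      moreover have "\<forall>j<2. int p dvd (\<Sum>i\<in>I - T. a i j)"
        using dvd_sum_complement[OF fin TI] I T by blast
      ultimately show ?thesis
        using False card_diff I M' by (intro exI[of _ "I - T"]) auto
    qed
  qed
qed

text \<open>
  In Vandermonde's identity for \<open>2p\<close> choose \<open>p\<close> only the two outer summands are prime to \<open>p\<close>, and
  both are \<open>1\<close>.
\<close>
lemma central_binomial_mod_prime:
  assumes "prime p"
  shows "int p dvd int ((2 * p) choose p) - 2"
proof -
  have "(\<Sum>k\<le>p. (p choose k)\<^sup>2) = (2 * p) choose p"
    by (rule choose_square_sum)
  also have "{..p} = insert 0 (insert p {1..<p})"
    using prime_gt_1_nat[OF assms] by auto
  finally have *: "(2 * p) choose p = 2 + (\<Sum>k\<in>{1..<p}. (p choose k)\<^sup>2)"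
    using prime_gt_1_nat[OF assms] by simp
  have "p dvd (\<Sum>k\<in>{1..<p}. (p choose k)\<^sup>2)"
    using assms by (intro dvd_sum) (auto simp: power2_eq_square intro!: dvd_mult2 dvd_choose_prime)
  then show ?thesis
    unfolding * by (simp only: of_nat_add of_nat_numeral add_diff_cancel_left' int_dvd_int_iff)
qed

text \<open>
  Leaving out one term, \<open>3p - 1\<close> vectors still contain a zero sum of length \<open>p\<close> or \<open>2p\<close>. In the
  second case the complement in \<open>M\<close> has length \<open>p\<close>.
\<close>
lemma zero_sum_of_length_from_triple:
  fixes a :: "nat \<Rightarrow> nat \<Rightarrow> int"
  assumes "prime p" "card M = 3 * p" "\<forall>j<2. int p dvd (\<Sum>i\<in>M. a i j)"
  shows "\<exists>I\<subseteq>M. card I = p \<and> (\<forall>j<2. int p dvd (\<Sum>i\<in>I. a i j))"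
proof -
  have p: "p > 1"
    using prime_gt_1_nat assms by blast
  have fin: "finite M"
    using assms(2) p by (metis card.infinite mult_is_0 not_one_less_zero zero_neq_numeral)
  obtain M' where M': "M' \<subseteq> M" "card M' = 3 * p - 1"
    using obtain_subset_with_card_n[of "3 * p - 1" M] assms(2) by force
  have "finite M'" "(2 + 1) * (p - 1) < card M'"
    using M' fin finite_subset p by auto
  then obtain I where I: "I \<subseteq> M'" "I \<noteq> {}" "p dvd card I" "\<forall>j<2. int p dvd (\<Sum>i\<in>I. a i j)"
    using zero_sum_length_dvd[OF assms(1), of M' 2 a] by blast
  have I_M: "I \<subseteq> M"
    using I M' by blast
  then have fI: "finite I"
    using fin finite_subset by blast
  obtain c where c: "card I = p * c"
    using I(3) by blast
  have "card I \<le> 3 * p - 1"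
    using I M' fin card_mono[of M' I] finite_subset by metis
  then have "p * c < p * 3"
    using c p by linarith
  then have "c < 3"
    by simp
  moreover have "c \<noteq> 0"
    using c I fI by auto
  ultimately consider "c = 1" | "c = 2"
    by linarith
  then show ?thesis
  proof cases
    case 1
    then show ?thesis
      using I I_M c by (intro exI[of _ I]) auto
  next
    case 2
    have "card (M - I) = p"
      using card_Diff_subset[OF fI I_M] 2 c assms(2) by simp
    moreover have "\<forall>j<2. int p dvd (\<Sum>i\<in>M - I. a i j)"
      using dvd_sum_complement[OF fin I_M] I assms(3) by blast
    ultimately show ?thesis
      by (intro exI[of _ "M - I"]) auto
  qed
qed

text \<open>
  Ronyai's bound \<open>4p - 2\<close> for a zero sum of length exactly \<open>p\<close> in the plane. Suppose that there is
  none. A non-empty zero sum whose length is divisible by \<open>p\<close> then has length \<open>2p\<close>, because one of length \<open>3p\<close>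
  would contain one of length \<open>p\<close>. The product of the tests for both coordinates and the length
  handles all other subsets; the additional factor, the elementary symmetric polynomial of degree
  \<open>p\<close> minus \<open>2\<close>, vanishes modulo \<open>p\<close> on subsets of size \<open>2p\<close>. The total degree is \<open>4p - 3\<close>, and at the
  empty set the value is \<open>-2\<close>, which is not divisible by an odd \<open>p\<close>.
\<close>
lemma zero_sum_of_length_plane:
  fixes a :: "nat \<Rightarrow> nat \<Rightarrow> int"
  assumes "prime p" "p \<noteq> 2" "finite M" "4 * p - 2 \<le> card M"
  shows "\<exists>I\<subseteq>M. card I = p \<and> (\<forall>j<2. int p dvd (\<Sum>i\<in>I. a i j))"
proof (rule ccontr)
  assume contra: "\<not> ?thesis"
  have p: "p > 1"
    using prime_gt_1_nat assms by blast
  obtain M' where M': "M' \<subseteq> M" "card M' = 4 * p - 2"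
    using obtain_subset_with_card_n[OF assms(4)] by metis
  have fin: "finite M'"
    using M' assms finite_subset by blast
  define h where "h j = (\<lambda>i. if j < 2 then a i j else 1)" for j :: nat
  define g where "g I = (\<Prod>j<3. vanishing_test p M' (h j) I)" for I
  (* The elementary symmetric polynomial counts the p-element subsets of I. *)
  define b where "b I = (\<Sum>T\<in>{T. T \<subseteq> M' \<and> card T = p}. of_bool (T \<subseteq> I)) - (2::int)" for I :: "nat set"
  have b_eq: "b I = int (card I choose p) - 2" if "I \<subseteq> M'" for I
  proof -
    have "(\<Sum>T\<in>{T. T \<subseteq> M' \<and> card T = p}. of_bool (T \<subseteq> I) :: int)
        = (\<Sum>T\<in>{T. T \<subseteq> I \<and> card T = p}. 1)"
      by (rule sum.mono_neutral_cong_right) (use fin that in auto)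
    also have "\<dots> = int (card I choose p)"
      using n_subsets[of I p] finite_subset[OF that fin] by simp
    finally show ?thesis
      by (simp add: b_def)
  qed
  have "cube_poly (3 * (p - 1)) g"
    unfolding g_def
    using cube_poly_prod[of "{..<3}" "p - 1" "\<lambda>j. vanishing_test p M' (h j)",
        OF _ cube_poly_vanishing_test] by simp
  moreover have "cube_poly p b"
    unfolding b_def using fin finite_subset
    by (intro cube_poly_diff cube_poly_const cube_poly_sum cube_poly.monomial) auto
  ultimately have "cube_poly (3 * (p - 1) + p) (\<lambda>I. g I * b I)"
    by (rule cube_poly_mult)
  then have "int p dvd g {} * b {}"
  proof (rule cube_poly_dvd_at_empty[OF _ fin])
    show "3 * (p - 1) + p < card M'"
      using M' p by simp
    fix I assume I: "I \<subseteq> M'" "I \<noteq> {}"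
    have fI: "finite I"
      using I fin finite_subset by blast
    show "int p dvd g I * b I"
    proof (cases "\<forall>j<3. int p dvd (\<Sum>i\<in>I. h j i)")
      case False
      then obtain j where "j < 3" "\<not> int p dvd (\<Sum>i\<in>I. h j i)"
        by blast
      then have "int p dvd g I"
        using dvd_prod_factor[of "{..<3}" j "int p" "\<lambda>j. vanishing_test p M' (h j) I"]
          dvd_vanishing_test[OF assms(1) fin I(1)] by (simp add: g_def)
      then show ?thesis
        by simp
    next
      case True
      then have "p dvd card I"
        using True[rule_format, of 2] by (simp add: h_def)
      then obtain c where c: "card I = p * c"
        by blast
      have zs: "\<forall>j<2. int p dvd (\<Sum>i\<in>I. a i j)"
      proof (intro allI impI)
        fix j :: nat assume "j < 2"
        then show "int p dvd (\<Sum>i\<in>I. a i j)"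
          using True[rule_format, of j] by (simp add: h_def)
      qed
      have "card I \<le> 4 * p - 2"
        using card_mono[OF fin I(1)] M' by simp
      then have "p * c < p * 4"
        using c p by linarith
      then have "c < 4"
        by simp
      moreover have "c \<noteq> 0"
        using c I fI by auto
      moreover have "c \<noteq> 1"
        using contra c zs I(1) M'(1) by (metis mult.right_neutral order_trans)
      moreover have "c \<noteq> 3"
        using zero_sum_of_length_from_triple[OF assms(1), of I a] contra c zs I M'
        by (metis dual_order.trans mult.commute)
      ultimately have "c = 2"
        by linarith
      then have "b I = int ((2 * p) choose p) - 2"
        using b_eq[OF I(1)] c by (simp add: mult.commute)
      then show ?thesis
        using central_binomial_mod_prime[OF assms(1)] by simp
    qed
  qed
  moreover have "g {} * b {} = -2"
    using p b_eq[of "{}"] by (simp add: g_def vanishing_test_empty[OF assms(1)])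
  ultimately have "int p dvd int 2"
    by simp
  then have "p dvd 2"
    by (simp only: int_dvd_int_iff)
  then have "p \<le> 2"
    by (rule dvd_imp_le) simp
  then show False
    using p assms(2) by simp
qed

section \<open>Zero sums modulo composite numbers\<close>

text \<open>
  Greedy choice: while fewer than \<open>k\<close> blocks of size at most \<open>s\<close> have been removed, at least \<open>L\<close> indices
  are left.
\<close>
lemma extract_disjoint_blocks:
  assumes "finite M" "L + k * s \<le> card M + s"
    and ex: "\<And>N. N \<subseteq> M \<Longrightarrow> L \<le> card N \<Longrightarrow> \<exists>I\<subseteq>N. I \<noteq> {} \<and> card I \<le> s \<and> P I"
  shows "\<exists>A. (\<forall>j<k. A j \<subseteq> M \<and> A j \<noteq> {} \<and> card (A j) \<le> s \<and> P (A j)) \<and> disjoint_family_on A {..<k}"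
  using assms(2)
proof (induction k)
  case 0
  then show ?case
    by (auto simp: disjoint_family_on_def)
next
  case (Suc k)
  then obtain A where A: "\<forall>j<k. A j \<subseteq> M \<and> A j \<noteq> {} \<and> card (A j) \<le> s \<and> P (A j)"
      "disjoint_family_on A {..<k}"
    by auto
  define U where "U = (\<Union>j<k. A j)"
  have "card U \<le> (\<Sum>j<k. card (A j))"
    unfolding U_def by (rule card_UN_le) simp
  also have "\<dots> \<le> k * s"
    using A(1) sum_bounded_above[of "{..<k}" "\<lambda>j. card (A j)" s] by simp
  finally have "card U \<le> k * s" .
  moreover have "card M - card U \<le> card (M - U)"
    using A(1) finite_subset[OF _ assms(1)] unfolding U_def by (intro diff_card_le_card_Diff) auto
  ultimately have "L \<le> card (M - U)"
    using Suc.prems by simp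
  then obtain I where I: "I \<subseteq> M - U" "I \<noteq> {}" "card I \<le> s" "P I"
    using ex[of "M - U"] by auto
  have "disjoint_family_on (A(k := I)) {..<Suc k}"
    using A(2) I(1) unfolding disjoint_family_on_def U_def by (auto simp: less_Suc_eq; blast)
  moreover have "\<forall>j<Suc k. (A(k := I)) j \<subseteq> M \<and> (A(k := I)) j \<noteq> {}
      \<and> card ((A(k := I)) j) \<le> s \<and> P ((A(k := I)) j)"
    using A(1) I by (auto simp: less_Suc_eq)
  ultimately show ?case
    by blast
qed

lemma extract_short_zero_sums:
  fixes a :: "nat \<Rightarrow> nat \<Rightarrow> int"
  assumes "short_zero_sum_bound d n L" "finite M" "L + k * n \<le> card M + n"
  shows "\<exists>A. (\<forall>j<k. A j \<subseteq> M \<and> A j \<noteq> {} \<and> card (A j) \<le> n \<and> (\<forall>t<d. int n dvd (\<Sum>i\<in>A j. a i t)))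
    \<and> disjoint_family_on A {..<k}"
proof (rule extract_disjoint_blocks[OF assms(2,3)])
  fix N assume N: "N \<subseteq> M" "L \<le> card N"
  obtain I where "I \<subseteq> N" "I \<noteq> {}" "card I \<le> n" "\<And>j. j < d \<Longrightarrow> int n dvd (\<Sum>i\<in>I. a i j)"
    using short_zero_sum_boundD[OF assms(1) finite_subset[OF N(1) assms(2)] N(2), where a = a] by blast
  then show "\<exists>I\<subseteq>N. I \<noteq> {} \<and> card I \<le> n \<and> (\<forall>t<d. int n dvd (\<Sum>i\<in>I. a i t))"
    by (intro exI[of _ I]) simp
qed

text \<open>
  The way from a quotient of the modulus back to the product: each block sum is a multiple of \<open>q\<close>, and
  if the divided block sums over \<open>J\<close> form a zero sum modulo \<open>r\<close>, then the union of these blocks is one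
  modulo \<open>q r\<close>.
\<close>
lemma dvd_sum_over_blocks:
  fixes f :: "nat \<Rightarrow> int" and q r :: int and A :: "nat \<Rightarrow> nat set"
  assumes "finite M" "\<And>j. j < k \<Longrightarrow> A j \<subseteq> M" "disjoint_family_on A {..<k}" "J \<subseteq> {..<k}"
    and "\<And>j. j < k \<Longrightarrow> q dvd (\<Sum>i\<in>A j. f i)"
    and "r dvd (\<Sum>j\<in>J. (\<Sum>i\<in>A j. f i) div q)"
  shows "q * r dvd (\<Sum>i\<in>(\<Union>j\<in>J. A j). f i)"
proof -
  have "(\<Sum>i\<in>(\<Union>j\<in>J. A j). f i) = (\<Sum>j\<in>J. \<Sum>i\<in>A j. f i)"
  proof (rule sum.UNION_disjoint)
    show "finite J"
      using finite_subset[OF assms(4)] by simp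
    show "\<forall>i\<in>J. finite (A i)"
      using finite_subset[OF assms(2) assms(1)] assms(4) by auto
    show "\<forall>i\<in>J. \<forall>j\<in>J. i \<noteq> j \<longrightarrow> A i \<inter> A j = {}"
      using assms(3,4) unfolding disjoint_family_on_def by blast
  qed
  also have "\<dots> = (\<Sum>j\<in>J. q * ((\<Sum>i\<in>A j. f i) div q))"
    using assms(4,5) by (intro sum.cong) auto
  also have "\<dots> = q * (\<Sum>j\<in>J. (\<Sum>i\<in>A j. f i) div q)"
    by (simp add: sum_distrib_left)
  finally show ?thesis
    using assms(6) by simp
qed

text \<open>
  A bound of the shape \<open>c (n - 1) + 1\<close> is multiplicative: from \<open>c (m n - 1) + 1\<close> vectors one can extract
  \<open>c (n - 1) + 1\<close> disjoint short zero sums modulo \<open>m\<close>, since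
  \<open>c (m - 1) + 1 + c (n - 1) m = c (m n - 1) + 1\<close>.
\<close>
lemma short_zero_sum_bound_mult:
  assumes "short_zero_sum_bound d m (c * (m - 1) + 1)" "short_zero_sum_bound d n (c * (n - 1) + 1)"
    and "m > 0" "n > 0"
  shows "short_zero_sum_bound d (m * n) (c * (m * n - 1) + 1)"
  unfolding short_zero_sum_bound_def
proof (intro allI impI, elim conjE)
  fix M :: "nat set" and a :: "nat \<Rightarrow> nat \<Rightarrow> int"
  assume M: "finite M" "c * (m * n - 1) + 1 \<le> card M"
  define k where "k = c * (n - 1) + 1"
  obtain m' n' where mn: "m = Suc m'" "n = Suc n'"
    using assms(3,4) gr0_implies_Suc by blast
  have "(c * (m - 1) + 1) + k * m \<le> card M + m"
    using M(2) by (simp add: k_def mn algebra_simps)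
  from extract_short_zero_sums[OF assms(1) M(1) this, where a = a]
  obtain A where A: "\<forall>j<k. A j \<subseteq> M \<and> A j \<noteq> {} \<and> card (A j) \<le> m \<and>
        (\<forall>t<d. int m dvd (\<Sum>i\<in>A j. a i t))" "disjoint_family_on A {..<k}"
    by (elim exE conjE) (rule that)
  obtain J where J: "J \<subseteq> {..<k}" "J \<noteq> {}" "card J \<le> n"
      "\<And>t. t < d \<Longrightarrow> int n dvd (\<Sum>j\<in>J. (\<Sum>i\<in>A j. a i t) div int m)"
    using short_zero_sum_boundD[OF assms(2), of "{..<k}" "\<lambda>j t. (\<Sum>i\<in>A j. a i t) div int m"]
    by (auto simp: k_def)
  define I where "I = (\<Union>j\<in>J. A j)"
  have finJ: "finite J"
    using finite_subset[OF J(1)] by simp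
  have "card I \<le> (\<Sum>j\<in>J. card (A j))"
    unfolding I_def by (rule card_UN_le[OF finJ])
  also have "\<dots> \<le> card J * m"
    using A(1) J(1) sum_bounded_above[of J "\<lambda>j. card (A j)" m] by auto
  also have "\<dots> \<le> m * n"
    using J(3) by simp
  finally have "card I \<le> m * n" .
  moreover have "I \<subseteq> M" "I \<noteq> {}"
    using A(1) J(1,2) by (auto simp: I_def)
  moreover have "int (m * n) dvd (\<Sum>i\<in>I. a i t)" if "t < d" for t
    unfolding I_def of_nat_mult
    by (rule dvd_sum_over_blocks[OF M(1) _ A(2) J(1)]) (use A(1) J(4) that in auto)
  ultimately show "\<exists>I\<subseteq>M. I \<noteq> {} \<and> card I \<le> m * n \<and> (\<forall>j<d. int (m * n) dvd (\<Sum>i\<in>I. a i j))"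
    by blast
qed

lemma short_zero_sum_bound_from_primes:
  assumes "\<And>p. prime p \<Longrightarrow> short_zero_sum_bound d p (c * (p - 1) + 1)" "n > 0"
  shows "short_zero_sum_bound d n (c * (n - 1) + 1)"
  using assms(2)
proof (induction n rule: less_induct)
  case (less n)
  show ?case
  proof (cases "n = 1")
    case True
    have "\<exists>I\<subseteq>M. I \<noteq> {} \<and> card I \<le> 1" if "1 \<le> card M" for M :: "nat set"
    proof -
      have "M \<noteq> {}"
        using that by auto
      then obtain i where "i \<in> M"
        by blast
      then show ?thesis
        by (intro exI[of _ "{i}"]) auto
    qed
    then show ?thesis
      using True by (simp add: short_zero_sum_bound_def)
  next
    case False
    then obtain p m where p: "prime p" "n = p * m"
      using prime_factor_nat dvdE by metis
    have "m > 0" "m < n"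
      using less.prems p prime_gt_1_nat[OF p(1)] by auto
    then show ?thesis
      using short_zero_sum_bound_mult[OF assms(1)[OF p(1)] less.IH[of m]] p prime_gt_0_nat by blast
  qed
qed

lemma short_zero_sum_cyclic: "n > 0 \<Longrightarrow> short_zero_sum_bound 1 n n"
proof -
  have "short_zero_sum_bound 1 p (1 * (p - 1) + 1)" if p: "prime p" for p
    unfolding short_zero_sum_bound_def
  proof (intro allI impI, elim conjE)
    fix M :: "nat set" and a :: "nat \<Rightarrow> nat \<Rightarrow> int"
    assume M: "finite M" "1 * (p - 1) + 1 \<le> card M"
    obtain M' where M': "M' \<subseteq> M" "card M' = 1 * (p - 1) + 1"
      using obtain_subset_with_card_n[OF M(2)] by metis
    have fin: "finite M'"
      using finite_subset[OF M'(1) M(1)] .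
    obtain I where I: "I \<subseteq> M'" "I \<noteq> {}" "\<forall>j<1. int p dvd (\<Sum>i\<in>I. a i j)"
      using zero_sum_elementary[OF p fin, of 1 a] M' by auto
    have "card I \<le> p"
      using card_mono[OF fin I(1)] M' prime_gt_0_nat[OF p] by simp
    then show "\<exists>I\<subseteq>M. I \<noteq> {} \<and> card I \<le> p \<and> (\<forall>j<1. int p dvd (\<Sum>i\<in>I. a i j))"
      using I M' by blast
  qed
  then show "n > 0 \<Longrightarrow> short_zero_sum_bound 1 n n"
    using short_zero_sum_bound_from_primes[of 1 1 n] by simp
qed

text \<open>
  Olson's theorem on groups of rank two. With a prime \<open>p\<close> dividing \<open>n\<close>, induction applies to
  \<open>n / p\<close> and \<open>m / p\<close>, for which \<open>n / p + m / p - 1\<close> disjoint zero sums modulo \<open>p\<close> are required.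
  All but the last are chosen of length at most \<open>p\<close>. The last one may be long, so that for it
  \<open>2p - 1\<close> remaining terms suffice; this saving makes the bound exact.
\<close>
lemma zero_sum_rank_two:
  fixes x y :: "nat \<Rightarrow> int"
  assumes "n dvd m" "m > 0" "finite M" "n + m - 1 \<le> card M"
  shows "\<exists>I\<subseteq>M. I \<noteq> {} \<and> int n dvd (\<Sum>i\<in>I. x i) \<and> int m dvd (\<Sum>i\<in>I. y i)"
  using assms
proof (induction n arbitrary: m M x y rule: less_induct)
  case (less n)
  have "n > 0"
    using less.prems(1,2) by (intro Nat.gr0I) auto
  show ?case
  proof (cases "n = 1")
    case True
    then show ?thesis
      using short_zero_sum_boundD[OF short_zero_sum_cyclic[OF less.prems(2)] less.prems(3), of "\<lambda>i j. y i"]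
        less.prems(4) by auto
  next
    case False
    then obtain p n' where p: "prime p" "n = p * n'"
      using prime_factor_nat dvdE by metis
    obtain m' where m': "m = n * m'"
      using less.prems(1) by blast
    define m1 where "m1 = n' * m'"
    have m1: "m = p * m1" "n' dvd m1"
      by (auto simp: m' m1_def p)
    have pos: "n' > 0" "m1 > 0" "p > 1"
      using \<open>n > 0\<close> p m1 less.prems(2) prime_gt_1_nat by auto
    define k where "k = n' + m1 - 2"
    have k: "n' + m1 = k + 2"
      using pos by (simp add: k_def)
    have card_M: "p * k + 2 * p - 1 \<le> card M"
      using less.prems(4) p m1 k by (metis add_mult_distrib2 mult.commute)
    define a where "a i j = (if j = 0 then x i else y i)" for i and j :: nat
    have a: "a i 0 = x i" "a i 1 = y i" for i
      by (auto simp: a_def)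
    have "(3 * (p - 1) + 1) + k * p \<le> card M + p"
      using card_M pos by (simp add: mult.commute)
    from extract_short_zero_sums[OF short_zero_sum_plane[OF p(1)] less.prems(3) this, where a = a]
    obtain A where A: "\<forall>j<k. A j \<subseteq> M \<and> A j \<noteq> {} \<and> card (A j) \<le> p \<and>
        (\<forall>t<2. int p dvd (\<Sum>i\<in>A j. a i t))" "disjoint_family_on A {..<k}"
      by (elim exE conjE) (rule that)
    define U where "U = (\<Union>j<k. A j)"
    have "card U \<le> (\<Sum>j<k. card (A j))"
      unfolding U_def by (rule card_UN_le) simp
    also have "\<dots> \<le> k * p"
      using A(1) sum_bounded_above[of "{..<k}" "\<lambda>j. card (A j)" p] by simp
    finally have "card U \<le> k * p" .
    moreover have "card M - card U \<le> card (M - U)"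
      using A(1) finite_subset[OF _ less.prems(3)] unfolding U_def
      by (intro diff_card_le_card_Diff) auto
    ultimately have "2 * (p - 1) < card (M - U)"
      using card_M pos by (simp add: mult.commute)
    then obtain B where B: "B \<subseteq> M - U" "B \<noteq> {}" "\<forall>j<2. int p dvd (\<Sum>i\<in>B. a i j)"
      using zero_sum_elementary[OF p(1), of "M - U" 2 a] less.prems(3) by auto
    define A' where "A' = A(k := B)"
    have disj: "disjoint_family_on A' {..<Suc k}"
      using A(2) B(1) unfolding disjoint_family_on_def U_def A'_def by (auto simp: less_Suc_eq; blast)
    have A': "A' j \<subseteq> M" "A' j \<noteq> {}" "\<forall>t<2. int p dvd (\<Sum>i\<in>A' j. a i t)" if "j < Suc k" for j
      using A(1) B that by (auto simp: less_Suc_eq A'_def)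
    have div_x: "int p dvd (\<Sum>i\<in>A' j. x i)" and div_y: "int p dvd (\<Sum>i\<in>A' j. y i)"
      if "j < Suc k" for j
      using A'(3)[OF that, rule_format, of 0] A'(3)[OF that, rule_format, of 1] by (simp_all add: a_def)
    have "n' < n"
      using p pos by simp
    moreover have "n' + m1 - 1 \<le> card {..<Suc k}"
      using k by simp
    ultimately obtain J where J: "J \<subseteq> {..<Suc k}" "J \<noteq> {}"
        "int n' dvd (\<Sum>j\<in>J. (\<Sum>i\<in>A' j. x i) div int p)"
        "int m1 dvd (\<Sum>j\<in>J. (\<Sum>i\<in>A' j. y i) div int p)"
      using less.IH[of n' m1 "{..<Suc k}"] m1(2) pos(2) by blast
    have "int p * int n' dvd (\<Sum>i\<in>(\<Union>j\<in>J. A' j). x i)"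
      by (rule dvd_sum_over_blocks[OF less.prems(3) A'(1) disj J(1) div_x J(3)])
    moreover have "int p * int m1 dvd (\<Sum>i\<in>(\<Union>j\<in>J. A' j). y i)"
      by (rule dvd_sum_over_blocks[OF less.prems(3) A'(1) disj J(1) div_y J(4)])
    ultimately show ?thesis
      using A'(1,2) J(1,2) p m1 by (intro exI[of _ "\<Union>j\<in>J. A' j"]) (auto, blast+)
  qed
qed

text \<open>
  Reduction modulo \<open>n1\<close> maps the group onto \<open>C\<^sub>n\<^sub>1\<^sup>3\<close> with a kernel of rank two, isomorphic to
  \<open>C\<^sub>k \<oplus> C\<^sub>l\<close> for \<open>k = n2 / n1\<close> and \<open>l = n3 / n1\<close>. Olson's theorem in the kernel asks for
  \<open>k + l - 1\<close> disjoint zero sums modulo \<open>n1\<close>, which can all be taken short.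
\<close>
lemma zero_sum_rank_three:
  fixes a :: "nat \<Rightarrow> nat \<Rightarrow> int"
  assumes short: "short_zero_sum_bound 3 n1 (c * (n1 - 1) + 1)"
    and "n1 dvd n2" "n2 dvd n3" "n1 > 0" "n2 > 0" "n3 > 0"
    and "finite M" "c * (n1 - 1) + 1 + n2 + n3 \<le> card M + 2 * n1"
  shows "\<exists>I\<subseteq>M. I \<noteq> {} \<and> int n1 dvd (\<Sum>i\<in>I. a i 0) \<and> int n2 dvd (\<Sum>i\<in>I. a i 1)
    \<and> int n3 dvd (\<Sum>i\<in>I. a i 2)"
proof -
  obtain m2 where m2: "n2 = n1 * m2"
    using assms(2) by blast
  obtain m3 where m3: "n3 = n2 * m3"
    using assms(3) by blast
  define l3 where "l3 = m2 * m3"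
  have l3: "n3 = n1 * l3" "m2 dvd l3"
    by (auto simp: l3_def m2 m3)
  have pos: "m2 > 0" "l3 > 0"
    using assms(5,6) m2 l3 by auto
  define k where "k = m2 + l3 - 1"
  have "k + 1 = m2 + l3"
    using pos by (simp add: k_def)
  then have "n2 + n3 = n1 + k * n1"
    by (metis add.commute add_mult_distrib2 l3(1) m2 mult.commute mult.right_neutral)
  then have "(c * (n1 - 1) + 1) + k * n1 \<le> card M + n1"
    using assms(8) by linarith
  from extract_short_zero_sums[OF short assms(7) this, where a = a]
  obtain A where A: "\<forall>j<k. A j \<subseteq> M \<and> A j \<noteq> {} \<and> card (A j) \<le> n1 \<and>
        (\<forall>t<3. int n1 dvd (\<Sum>i\<in>A j. a i t))" "disjoint_family_on A {..<k}"
    by (elim exE conjE) (rule that)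
  have "m2 + l3 - 1 \<le> card {..<k}"
    by (simp add: k_def)
  from zero_sum_rank_two[OF l3(2) pos(2) _ this]
  obtain J where J: "J \<subseteq> {..<k}" "J \<noteq> {}"
      "int m2 dvd (\<Sum>j\<in>J. (\<Sum>i\<in>A j. a i 1) div int n1)"
      "int l3 dvd (\<Sum>j\<in>J. (\<Sum>i\<in>A j. a i 2) div int n1)"
    by (meson finite_lessThan)
  define I where "I = (\<Union>j\<in>J. A j)"
  have "int n1 * 1 dvd (\<Sum>i\<in>I. a i 0)"
    unfolding I_def by (rule dvd_sum_over_blocks[OF assms(7) _ A(2) J(1)]) (use A(1) in auto)
  moreover have "int n1 * int m2 dvd (\<Sum>i\<in>I. a i 1)"
    unfolding I_def by (rule dvd_sum_over_blocks[OF assms(7) _ A(2) J(1) _ J(3)]) (use A(1) in auto)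
  moreover have "int n1 * int l3 dvd (\<Sum>i\<in>I. a i 2)"
    unfolding I_def by (rule dvd_sum_over_blocks[OF assms(7) _ A(2) J(1) _ J(4)]) (use A(1) in auto)
  moreover have "I \<subseteq> M" "I \<noteq> {}"
    using A(1) J(1,2) by (auto simp: I_def)
  ultimately show ?thesis
    using m2 l3(1) by auto
qed

section \<open>Short zero sums in dimension three: small primes\<close>

lemma cong_multiple_mod_prime:
  fixes x y :: int
  assumes "prime p" "\<not> int p dvd x"
  shows "\<exists>c<p. int p dvd y - int c * x"
proof -
  have p: "p > 0"
    using prime_gt_0_nat assms(1) by blast
  have "coprime x (int p)"
    using assms prime_imp_coprime[of "int p" x] by (simp add: coprime_commute)
  then obtain u where u: "[x * u = 1] (mod int p)"
    using cong_solve_coprime_int by blast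
  define c where "c = nat (u * y mod int p)"
  have "c < p"
    using p by (simp add: c_def nat_less_iff)
  moreover have "[int c * x = u * y * x] (mod int p)"
    using p by (simp add: c_def cong_def mod_mult_left_eq)
  moreover have "[u * y * x = y] (mod int p)"
    using cong_mult[OF u cong_refl[of y]] by (simp add: mult.assoc mult.commute mult.left_commute)
  ultimately show ?thesis
    by (metis cong_iff_dvd_diff cong_sym cong_trans)
qed

lemma all_less_three: "(\<forall>j<3. P j) \<longleftrightarrow> P 0 \<and> P 1 \<and> P (2::nat)"
  by (simp add: numeral_3_eq_3 numeral_2_eq_2 All_less_Suc conj_ac)

text \<open>
  The \<open>p + 1\<close> planes through a fixed line cover \<open>C\<^sub>p\<^sup>3\<close>, and each of them contains at most
  \<open>3 (p - 1)\<close> terms of a sequence without a short zero sum.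
\<close>
lemma short_zero_sum_small_prime:
  assumes p: "prime p" and "3 * (p + 1) \<le> c"
  shows "short_zero_sum_bound 3 p (c * (p - 1) + 1)"
  unfolding short_zero_sum_bound_def
proof (intro allI impI, elim conjE, rule ccontr)
  fix M :: "nat set" and a :: "nat \<Rightarrow> nat \<Rightarrow> int"
  assume M: "finite M" "c * (p - 1) + 1 \<le> card M"
  assume contra: "\<not> (\<exists>I\<subseteq>M. I \<noteq> {} \<and> card I \<le> p \<and> (\<forall>j<3. int p dvd (\<Sum>i\<in>I. a i j)))"
  define Z where "Z = {i\<in>M. int p dvd a i 0}"
  define N where "N c = {i\<in>M. int p dvd a i 1 - int c * a i 0}" for c :: nat
  have "card Z \<le> 3 * (p - 1)"
  proof (rule ccontr)
    assume "\<not> ?thesis"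
    then have "3 * (p - 1) + 1 \<le> card Z" and "finite Z"
      using M(1) by (auto simp: Z_def)
    then obtain I where I: "I \<subseteq> Z" "I \<noteq> {}" "card I \<le> p" "\<And>j. j < 2 \<Longrightarrow> int p dvd (\<Sum>i\<in>I. a i (j + 1))"
      using short_zero_sum_boundD[OF short_zero_sum_plane[OF p], of Z "\<lambda>i j. a i (j + 1)"] by blast
    have "int p dvd (\<Sum>i\<in>I. a i 0)"
      using I(1) by (intro dvd_sum) (auto simp: Z_def)
    then show False
      using contra I I(4)[of 0] I(4)[of 1] unfolding all_less_three Z_def
      by (auto simp: numeral_2_eq_2)
  qed
  moreover have "card (N c) \<le> 3 * (p - 1)" for c
  proof (rule ccontr)
    assume "\<not> ?thesis"
    then have "3 * (p - 1) + 1 \<le> card (N c)" and "finite (N c)"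
      using M(1) by (auto simp: N_def)
    then obtain I where I: "I \<subseteq> N c" "I \<noteq> {}" "card I \<le> p" "\<And>j. j < 2 \<Longrightarrow> int p dvd (\<Sum>i\<in>I. a i (2 * j))"
      using short_zero_sum_boundD[OF short_zero_sum_plane[OF p], of "N c" "\<lambda>i j. a i (2 * j)"] by blast
    have "int p dvd (\<Sum>i\<in>I. a i 1 - int c * a i 0)"
      using I(1) by (intro dvd_sum) (auto simp: N_def)
    then have d1: "int p dvd (\<Sum>i\<in>I. a i 1) - int c * (\<Sum>i\<in>I. a i 0)"
      by (simp add: sum_subtractf sum_distrib_left)
    have d0: "int p dvd (\<Sum>i\<in>I. a i 0)"
      using I(4)[of 0] by simp
    have "int p dvd (\<Sum>i\<in>I. a i 1)"
      using dvd_add[OF d1 dvd_mult[OF d0, of "int c"]] by simp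
    then show False
      using contra I I(4)[of 0] I(4)[of 1] unfolding all_less_three N_def by auto
  qed
  ultimately have "card Z + (\<Sum>c<p. card (N c)) \<le> 3 * (p - 1) + p * (3 * (p - 1))"
    using sum_bounded_above[of "{..<p}" "\<lambda>c. card (N c)" "3 * (p - 1)"] by (intro add_mono) simp_all
  moreover have "M = Z \<union> (\<Union>c<p. N c)"
    using cong_multiple_mod_prime[OF p] by (auto simp: Z_def N_def)
  then have "card M \<le> card Z + (\<Sum>c<p. card (N c))"
    using card_Un_le[of Z "\<Union>c<p. N c"] card_UN_le[of "{..<p}" N] by simp
  ultimately have "card M \<le> (3 * (p + 1)) * (p - 1)"
    by (simp add: algebra_simps)
  also have "\<dots> \<le> c * (p - 1)"
    using assms(2) mult_le_mono1 by blast
  finally show False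
    using M(2) by simp
qed

section \<open>Translates of a set of residue vectors\<close>

type_synonym vec = "int \<times> int \<times> int"

fun reduce :: "nat \<Rightarrow> vec \<Rightarrow> vec" where
  "reduce p (x, y, z) = (x mod int p, y mod int p, z mod int p)"

fun dot :: "vec \<Rightarrow> vec \<Rightarrow> int" where
  "dot (v1, v2, v3) (x1, x2, x3) = v1 * x1 + v2 * x2 + v3 * x3"

definition grid :: "nat \<Rightarrow> vec set" where
  "grid p = {0..<int p} \<times> {0..<int p} \<times> {0..<int p}"

lemma finite_grid [simp]: "finite (grid p)"
  by (simp add: grid_def)

lemma card_grid: "card (grid p) = p ^ 3"
  by (simp add: grid_def card_cartesian_product power3_eq_cube)

lemma reduce_in_grid: "p > 0 \<Longrightarrow> reduce p x \<in> grid p"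
  by (cases x) (simp add: grid_def)

lemma reduce_grid: "x \<in> grid p \<Longrightarrow> reduce p x = x"
  by (cases x) (auto simp: grid_def)

lemma reduce_add_left: "reduce p (reduce p x + y) = reduce p (x + y)"
  by (cases x, cases y) (simp add: mod_simps)

lemma reduce_add_right: "reduce p (x + reduce p y) = reduce p (x + y)"
  by (cases x, cases y) (simp add: mod_simps)

lemma reduce_idem: "reduce p (reduce p x) = reduce p x"
  by (cases x) simp

lemma reduce_eq_iff: "reduce p x = reduce p y \<longleftrightarrow> reduce p (x - y) = 0"
  by (cases x, cases y) (simp add: zero_prod_def mod_eq_dvd_iff dvd_eq_mod_eq_0)

lemma reduce_eq_0_iff: "reduce p (x, y, z) = 0 \<longleftrightarrow> int p dvd x \<and> int p dvd y \<and> int p dvd z"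
  by (simp add: zero_prod_def dvd_eq_mod_eq_0)

lemma reduce_minus_eq_0_iff: "reduce p (- x) = 0 \<longleftrightarrow> reduce p x = 0"
  by (cases x) (simp add: zero_prod_def flip: dvd_eq_mod_eq_0)

lemma dot_add_right: "dot v (x + y) = dot v x + dot v y"
  by (cases v, cases x, cases y) (simp add: algebra_simps)

lemma dot_diff_right: "dot v (x - y) = dot v x - dot v y"
  by (cases v, cases x, cases y) (simp add: algebra_simps)

definition shift :: "nat \<Rightarrow> vec \<Rightarrow> vec set \<Rightarrow> vec set" where
  "shift p x B = (\<lambda>b. reduce p (b + x)) ` B"

text \<open>
  How many translates of elements of \<open>B\<close> by \<open>x\<close> fall outside \<open>B\<close>. If \<open>B\<close> is a set of subset sums,
  this is the number of new sums gained by adjoining a term \<open>x\<close>. For a fixed \<open>B\<close> the count is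
  subadditive in \<open>x\<close>, so lower bounds for its average over many combinations of terms give lower
  bounds for single terms.
\<close>
definition escape :: "nat \<Rightarrow> vec set \<Rightarrow> vec \<Rightarrow> nat" where
  "escape p B x = card (shift p x B - B)"

lemma shift_subset_grid: "p > 0 \<Longrightarrow> shift p x B \<subseteq> grid p"
  by (auto simp: shift_def reduce_in_grid)

lemma inj_on_shift: "inj_on (\<lambda>b. reduce p (b + x)) (grid p)"
proof (rule inj_onI)
  fix b c assume "b \<in> grid p" "c \<in> grid p" and eq: "reduce p (b + x) = reduce p (c + x)"
  have "reduce p b = reduce p c"
    using eq unfolding reduce_eq_iff[of p "b + x"] reduce_eq_iff[of p b] by simp
  then show "b = c"
    using \<open>b \<in> grid p\<close> \<open>c \<in> grid p\<close> by (simp add: reduce_grid)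
qed

lemma card_shift: "B \<subseteq> grid p \<Longrightarrow> card (shift p x B) = card B"
  unfolding shift_def by (rule card_image) (rule inj_on_subset[OF inj_on_shift])

lemma shift_add: "shift p (x + y) B = shift p y (shift p x B)"
  by (simp add: shift_def image_image reduce_add_left add.assoc)

lemma card_shift_Int:
  assumes "B \<subseteq> grid p"
  shows "card (shift p x B \<inter> B) + escape p B x = card B"
proof -
  have fin: "finite (shift p x B)"
    using finite_subset[OF assms] by (simp add: shift_def)
  have "card (shift p x B \<inter> B) + card (shift p x B - B) = card (shift p x B)"
    using card_Int_Diff[OF fin] by simp
  then show ?thesis
    by (simp add: escape_def card_shift[OF assms])
qed

text \<open>
  An element that leaves \<open>B\<close> under \<open>x + y\<close> leaves it under \<open>x\<close>, or stays in \<open>B\<close> and then leaves it under \<open>y\<close>.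
\<close>
lemma escape_add:
  assumes "B \<subseteq> grid p" "p > 0"
  shows "escape p B (x + y) \<le> escape p B x + escape p B y"
proof -
  have fin: "finite (shift p z C)" if "C \<subseteq> grid p" for z C
    using finite_subset[OF that] by (simp add: shift_def)
  have sub: "shift p x B - B \<subseteq> grid p"
    using shift_subset_grid[OF assms(2)] by blast
  have "shift p (x + y) B - B \<subseteq> shift p y (shift p x B - B) \<union> (shift p y B - B)"
    unfolding shift_add by (auto simp: shift_def)
  then have "escape p B (x + y) \<le> card (shift p y (shift p x B - B) \<union> (shift p y B - B))"
    unfolding escape_def by (intro card_mono) (use fin[OF sub] fin[OF assms(1)] in auto)
  also have "\<dots> \<le> card (shift p y (shift p x B - B)) + card (shift p y B - B)"
    by (rule card_Un_le)
  finally show ?thesis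
    by (simp add: escape_def card_shift[OF sub])
qed

fun scale :: "int \<Rightarrow> vec \<Rightarrow> vec" where
  "scale k (x, y, z) = (k * x, k * y, k * z)"

lemma escape_scale:
  assumes "B \<subseteq> grid p" "p > 0"
  shows "escape p B (scale (int k) x) \<le> k * escape p B x"
proof (induction k)
  case 0
  have "shift p (scale 0 x) B = B"
  proof -
    have "scale 0 x = 0"
      by (cases x) (simp add: zero_prod_def)
    then have "shift p (scale 0 x) B = id ` B"
      unfolding shift_def
      by (intro image_cong) (simp_all add: reduce_grid subsetD[OF assms(1)])
    then show ?thesis
      by simp
  qed
  then show ?case
    by (simp add: escape_def)
next
  case (Suc k)
  have "scale (int (Suc k)) x = scale (int k) x + x"
    by (cases x) (simp add: algebra_simps)
  then show ?case
    using escape_add[OF assms, of "scale (int k) x" x] Suc by simp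
qed

text \<open>
  A pair of elements of \<open>B\<close> has only one difference modulo \<open>p\<close>, so it is counted for at most one \<open>x\<close>.
\<close>
lemma sum_card_shift_Int_le:
  assumes B: "B \<subseteq> grid p" and "finite X" and inj: "inj_on (reduce p) X"
  shows "(\<Sum>x\<in>X. card (shift p x B \<inter> B)) \<le> card B * card B"
proof -
  have finB: "finite B"
    using finite_subset[OF B] by simp
  define \<phi> :: "vec \<times> vec \<Rightarrow> vec \<times> vec" where "\<phi> = (\<lambda>(x, c). (c, reduce p (c - x)))"
  have "(\<Sum>x\<in>X. card (shift p x B \<inter> B)) = card (SIGMA x:X. shift p x B \<inter> B)"
    using finB assms(2) by (simp add: card_SigmaI)
  also have "\<dots> \<le> card (B \<times> B)"
  proof (rule card_inj_on_le[of \<phi>])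
    show "inj_on \<phi> (SIGMA x:X. shift p x B \<inter> B)"
    proof (rule inj_onI)
      fix s t assume st: "s \<in> (SIGMA x:X. shift p x B \<inter> B)" "t \<in> (SIGMA x:X. shift p x B \<inter> B)"
        "\<phi> s = \<phi> t"
      obtain x y c where s: "s = (x, c)" and t: "t = (y, c)"
        using st(3) unfolding \<phi>_def by (cases s, cases t) auto
      have *: "x \<in> X" "y \<in> X" "reduce p (c - x) = reduce p (c - y)"
        using st unfolding s t \<phi>_def by auto
      then have "reduce p (y - x) = 0"
        unfolding reduce_eq_iff[of p "c - x"] by simp
      then have "reduce p y = reduce p x"
        by (simp add: reduce_eq_iff)
      then show "s = t"
        using * inj unfolding s t by (auto dest: inj_onD)
    qed
    show "\<phi> ` (SIGMA x:X. shift p x B \<inter> B) \<subseteq> B \<times> B"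
    proof (rule image_subsetI)
      fix s assume "s \<in> (SIGMA x:X. shift p x B \<inter> B)"
      then obtain x b where s: "s = (x, reduce p (b + x))" "b \<in> B" "reduce p (b + x) \<in> B"
        unfolding shift_def by auto
      have "reduce p (reduce p (b + x) - x) = reduce p (b + x - x)"
        using reduce_add_left[of p "b + x" "- x"] by simp
      then show "\<phi> s \<in> B \<times> B"
        using s reduce_grid[OF subsetD[OF B s(2)]] by (simp add: \<phi>_def)
    qed
  qed (use finB in simp)
  also have "\<dots> = card B * card B"
    by (simp add: card_cartesian_product)
  finally show ?thesis .
qed

text \<open>
  An isoperimetric inequality: taking \<open>h\<close> of order \<open>b\<^sup>1\<^sup>/\<^sup>3\<close>, where \<open>b\<close> is the size of \<open>B\<close>, one of three
  independent vectors moves a number of elements of order \<open>b\<^sup>2\<^sup>/\<^sup>3\<close> out of \<open>B\<close>. The combinations of the basis with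
  coefficients below \<open>h\<close> are \<open>h\<^sup>3\<close> different vectors, at least \<open>8 b\<close> many, so on average such a
  combination keeps at most \<open>b / 8\<close> elements inside \<open>B\<close>. By subadditivity it moves out at most
  \<open>3 (h - 1)\<close> times as many elements as the best basis vector.
\<close>
lemma exists_escape_of_basis:
  assumes B: "B \<subseteq> grid p" and p: "p > 0" and h: "0 < h" "h \<le> p" "8 * card B \<le> h ^ 3"
    and indep: "\<And>d1 d2 d3. \<bar>d1\<bar> < int p \<Longrightarrow> \<bar>d2\<bar> < int p \<Longrightarrow> \<bar>d3\<bar> < int p \<Longrightarrow>
        reduce p (scale d1 e1 + scale d2 e2 + scale d3 e3) = 0 \<Longrightarrow> d1 = 0 \<and> d2 = 0 \<and> d3 = 0"
  shows "\<exists>e\<in>{e1, e2, e3}. 7 * card B \<le> 24 * (h - 1) * escape p B e"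
proof -
  define g where "g = Max {escape p B e1, escape p B e2, escape p B e3}"
  have "g \<in> {escape p B e1, escape p B e2, escape p B e3}"
    unfolding g_def by (rule Max_in) auto
  then obtain e where e: "e \<in> {e1, e2, e3}" "g = escape p B e"
    by blast
  have g: "escape p B e1 \<le> g" "escape p B e2 \<le> g" "escape p B e3 \<le> g"
    unfolding g_def by (rule Max_ge; simp)+
  define K where "K = {..<h} \<times> {..<h} \<times> {..<h}"
  define \<psi> :: "nat \<times> nat \<times> nat \<Rightarrow> vec" where
    "\<psi> = (\<lambda>(k1, k2, k3). scale (int k1) e1 + scale (int k2) e2 + scale (int k3) e3)"
  have K: "finite K" "card K = h ^ 3"
    by (simp_all add: K_def card_cartesian_product power3_eq_cube)
  have inj: "inj_on (\<lambda>k. reduce p (\<psi> k)) K"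
  proof (rule inj_onI)
    fix k l assume kl: "k \<in> K" "l \<in> K" "reduce p (\<psi> k) = reduce p (\<psi> l)"
    obtain k1 k2 k3 l1 l2 l3 where k: "k = (k1, k2, k3)" and l: "l = (l1, l2, l3)"
      by (cases k, cases l)
    have "\<psi> k - \<psi> l = scale (int k1 - int l1) e1 + scale (int k2 - int l2) e2 + scale (int k3 - int l3) e3"
      unfolding k l \<psi>_def by (cases e1, cases e2, cases e3) (simp add: algebra_simps)
    then have "reduce p (scale (int k1 - int l1) e1 + scale (int k2 - int l2) e2 + scale (int k3 - int l3) e3) = 0"
      using kl(3) by (simp add: reduce_eq_iff)
    then have "int k1 - int l1 = 0 \<and> int k2 - int l2 = 0 \<and> int k3 - int l3 = 0"
      by (intro indep) (use kl h(2) in \<open>auto simp: K_def k l\<close>)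
    then show "k = l"
      by (simp add: k l)
  qed
  have inj\<psi>: "inj_on \<psi> K" and inj': "inj_on (reduce p) (\<psi> ` K)"
    using inj by (auto simp: inj_on_def)
  have "(\<Sum>k\<in>K. card (shift p (\<psi> k) B \<inter> B)) \<le> card B * card B"
    using sum_card_shift_Int_le[OF B _ inj'] K(1) by (simp add: sum.reindex[OF inj\<psi>])
  moreover have "(\<Sum>k\<in>K. card (shift p (\<psi> k) B \<inter> B)) + (\<Sum>k\<in>K. escape p B (\<psi> k)) = h ^ 3 * card B"
    using card_shift_Int[OF B] by (simp flip: sum.distrib add: K(2))
  moreover have "(\<Sum>k\<in>K. escape p B (\<psi> k)) \<le> h ^ 3 * (3 * (h - 1) * g)"
  proof -
    have "escape p B (\<psi> k) \<le> 3 * (h - 1) * g" if "k \<in> K" for k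
    proof -
      obtain k1 k2 k3 where k: "k = (k1, k2, k3)"
        by (cases k)
      have le: "escape p B (scale (int j) x) \<le> (h - 1) * g" if "j < h" "escape p B x \<le> g" for j x
        using escape_scale[OF B p, of j x] mult_mono[of j "h - 1" "escape p B x" g] that by linarith
      have "escape p B (\<psi> k) \<le> escape p B (scale (int k1) e1) + escape p B (scale (int k2) e2)
          + escape p B (scale (int k3) e3)"
        unfolding k \<psi>_def using escape_add[OF B p, of "scale (int k1) e1" "scale (int k2) e2"]
          escape_add[OF B p, of "scale (int k1) e1 + scale (int k2) e2" "scale (int k3) e3"]
        by simp
      also have "\<dots> \<le> (h - 1) * g + (h - 1) * g + (h - 1) * g"
        using that g by (intro add_mono le) (auto simp: K_def k)
      finally show ?thesis
        by simp
    qed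
    then show ?thesis
      using sum_bounded_above[of K "\<lambda>k. escape p B (\<psi> k)" "3 * (h - 1) * g"] K(2) by simp
  qed
  ultimately have "h ^ 3 * card B \<le> card B * card B + h ^ 3 * (3 * (h - 1) * g)"
    by linarith
  then have "8 * (h ^ 3 * card B) \<le> (8 * card B) * card B + 8 * (h ^ 3 * (3 * (h - 1) * g))"
    by linarith
  also have "\<dots> \<le> h ^ 3 * card B + 8 * (h ^ 3 * (3 * (h - 1) * g))"
    using mult_le_mono1[OF h(3)] by simp
  finally have "h ^ 3 * (7 * card B) \<le> h ^ 3 * (24 * (h - 1) * g)"
    by (simp only: algebra_simps)
  then have "7 * card B \<le> 24 * (h - 1) * g"
    using h(1) by (metis nat_mult_le_cancel1 zero_less_power)
  then show ?thesis
    using e by blast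
qed

section \<open>Spectral formula for the escape count\<close>

definition angle :: "nat \<Rightarrow> vec \<Rightarrow> vec \<Rightarrow> real" where
  "angle p v x = 2 * pi * real_of_int (dot v x) / real p"

lemma angle_add: "angle p v (x + y) = angle p v x + angle p v y"
  by (simp add: angle_def dot_add_right algebra_simps add_divide_distrib)

lemma angle_diff: "angle p v (x - y) = angle p v x - angle p v y"
  by (simp add: angle_def dot_diff_right algebra_simps diff_divide_distrib)

lemma angle_scale: "angle p v (scale k x) = real_of_int k * angle p v x"
  by (cases v, cases x) (simp add: angle_def algebra_simps)

lemma sum_cis_residues:
  assumes "p > 0"
  shows "(\<Sum>v\<in>{0..<int p}. cis (2 * pi * real_of_int (v * y) / real p))
    = (if int p dvd y then of_nat p else 0)"
proof -
  define z where "z = cis (2 * pi * real_of_int y / real p)"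
  have z: "cis (2 * pi * real_of_int (int k * y) / real p) = z ^ k" for k
    by (simp add: z_def DeMoivre mult_ac)
  have "{0..<int p} = int ` {..<p}"
    using image_int_atLeastLessThan[of 0 p] by (simp add: lessThan_atLeast0)
  then have sum: "(\<Sum>v\<in>{0..<int p}. cis (2 * pi * real_of_int (v * y) / real p)) = (\<Sum>k<p. z ^ k)"
    by (simp only: sum.reindex[OF inj_on_of_nat] o_def z)
  have zp: "z ^ p = 1"
  proof -
    have "z ^ p = cis (2 * pi * real_of_int y)"
      using assms by (simp add: z_def DeMoivre)
    then show ?thesis
      by (simp add: cis_multiple_2pi)
  qed
  show ?thesis
  proof (cases "int p dvd y")
    case True
    then obtain q where "y = int p * q"
      by blast
    then have "z = 1"
      using assms cis_multiple_2pi[of "real_of_int q"] by (simp add: z_def mult.assoc)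
    then show ?thesis
      using True by (simp only: sum) simp
  next
    case False
    have "z \<noteq> 1"
    proof
      assume "z = 1"
      then have "cos (2 * pi * real_of_int y / real p) = 1"
        by (simp add: z_def complex_eq_iff)
      then obtain n :: int where "2 * pi * real_of_int y / real p = of_int n * 2 * pi"
        by (auto simp: cos_one_2pi_int)
      then have "real_of_int y = real_of_int (n * int p)"
        using assms by (simp add: field_simps)
      then have "y = n * int p"
        by (simp only: of_int_eq_iff)
      then show False
        using False by simp
    qed
    then show ?thesis
      using False zp geometric_sum[of z p] by (simp only: sum) simp
  qed
qed

lemma sum_cos_angle:
  assumes "p > 0"
  shows "(\<Sum>v\<in>grid p. cos (angle p v y)) = (if reduce p y = 0 then real p ^ 3 else 0)"
proof -
  obtain y1 y2 y3 where y: "y = (y1, y2, y3)"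
    by (cases y)
  define c where "c t v = cis (2 * pi * real_of_int (v * t) / real p)" for t v :: int
  have "cis (angle p (v1, v2, v3) y) = c y1 v1 * (c y2 v2 * c y3 v3)" for v1 v2 v3
    by (simp add: c_def angle_def y cis_mult algebra_simps add_divide_distrib)
  then have "(\<Sum>v\<in>grid p. cis (angle p v y))
      = (\<Sum>v1\<in>{0..<int p}. \<Sum>v2\<in>{0..<int p}. \<Sum>v3\<in>{0..<int p}. c y1 v1 * (c y2 v2 * c y3 v3))"
    by (simp add: grid_def sum.cartesian_product' case_prod_unfold)
  also have "\<dots> = (\<Sum>v\<in>{0..<int p}. c y1 v) * ((\<Sum>v\<in>{0..<int p}. c y2 v) * (\<Sum>v\<in>{0..<int p}. c y3 v))"
    by (simp only: sum_distrib_left[symmetric] sum_distrib_right[symmetric])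
  also have "\<dots> = (if reduce p y = 0 then of_nat (p ^ 3) else 0)"
    using sum_cis_residues[OF assms] unfolding c_def y reduce_eq_0_iff by (simp add: power3_eq_cube)
  finally have "Re (\<Sum>v\<in>grid p. cis (angle p v y)) = Re (if reduce p y = 0 then of_nat (p ^ 3) else 0)"
    by simp
  then show ?thesis
    by (auto split: if_splits simp: Re_sum)
qed

text \<open>
  The squared modulus of the Fourier coefficient of the indicator function of \<open>B\<close> at the character
  \<open>v\<close>, in real form.
\<close>
definition spectral_weight :: "nat \<Rightarrow> vec set \<Rightarrow> vec \<Rightarrow> real" where
  "spectral_weight p B v = (\<Sum>b\<in>B. cos (angle p v b))\<^sup>2 + (\<Sum>b\<in>B. sin (angle p v b))\<^sup>2"

lemma spectral_weight_nonneg: "spectral_weight p B v \<ge> 0"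
  by (simp add: spectral_weight_def)

lemma spectral_weight_zero: "spectral_weight p B 0 = (real (card B))\<^sup>2"
proof -
  have "dot 0 b = 0" for b
    by (cases b) (simp add: zero_prod_def)
  then show ?thesis
    by (simp add: spectral_weight_def angle_def)
qed

lemma spectral_weight_eq: "spectral_weight p B v = (\<Sum>b\<in>B. \<Sum>c\<in>B. cos (angle p v (b - c)))"
  by (simp add: spectral_weight_def power2_eq_square sum_product angle_diff cos_diff sum.distrib)

text \<open>
  Parseval's identity.
\<close>
lemma sum_spectral_weight:
  assumes "p > 0" "B \<subseteq> grid p"
  shows "(\<Sum>v\<in>grid p. spectral_weight p B v) = real p ^ 3 * real (card B)"
proof -
  have finB: "finite B"
    using finite_subset[OF assms(2)] by simp
  have eq: "reduce p (b - c) = 0 \<longleftrightarrow> b = c" if "b \<in> B" "c \<in> B" for b c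
    using that assms(2) reduce_grid unfolding reduce_eq_iff[symmetric] by (metis subsetD)
  have "(\<Sum>v\<in>grid p. spectral_weight p B v) = (\<Sum>b\<in>B. \<Sum>c\<in>B. \<Sum>v\<in>grid p. cos (angle p v (b - c)))"
    unfolding spectral_weight_eq by (subst sum.swap) (rule sum.cong[OF refl], rule sum.swap)
  also have "\<dots> = (\<Sum>b\<in>B. \<Sum>c\<in>B. if b = c then real p ^ 3 else 0)"
    using eq by (intro sum.cong refl) (simp add: sum_cos_angle[OF assms(1)])
  also have "\<dots> = real p ^ 3 * real (card B)"
    using finB by simp
  finally show ?thesis .
qed

text \<open>
  Expanding the weight as a sum over pairs, orthogonality of characters leaves the pairs with
  difference \<open>x\<close> or \<open>-x\<close>, which are equally many.
\<close>
lemma sum_spectral_weight_cos: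
  assumes "p > 0" "B \<subseteq> grid p"
  shows "(\<Sum>v\<in>grid p. spectral_weight p B v * cos (angle p v x)) = real p ^ 3 * real (card (shift p x B \<inter> B))"
proof -
  have finB: "finite B"
    using finite_subset[OF assms(2)] by simp
  have hit: "reduce p (b - c + x) = 0 \<longleftrightarrow> c = reduce p (b + x)" if "c \<in> B" for b c
  proof -
    have "reduce p (b - c + x) = 0 \<longleftrightarrow> reduce p (b + x) = reduce p c"
      by (simp add: reduce_eq_iff algebra_simps)
    then show ?thesis
      using that assms(2) reduce_grid by (metis subsetD)
  qed
  have inner: "(\<Sum>b\<in>B. \<Sum>c\<in>B. if reduce p (b - c + x) = 0 then real p ^ 3 else 0)
      = real p ^ 3 * real (card (shift p x B \<inter> B))"
  proof -
    have "(\<Sum>b\<in>B. \<Sum>c\<in>B. if reduce p (b - c + x) = 0 then real p ^ 3 else 0)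
        = (\<Sum>b\<in>B. \<Sum>c\<in>B. if c = reduce p (b + x) then real p ^ 3 else 0)"
      using hit by (intro sum.cong refl) auto
    also have "\<dots> = (\<Sum>b\<in>B. if reduce p (b + x) \<in> B then real p ^ 3 else 0)"
      using finB by simp
    also have "\<dots> = real p ^ 3 * real (card {b\<in>B. reduce p (b + x) \<in> B})"
      using finB by (simp add: sum.If_cases Int_def)
    also have "card {b\<in>B. reduce p (b + x) \<in> B} = card ((\<lambda>b. reduce p (b + x)) ` {b\<in>B. reduce p (b + x) \<in> B})"
      by (rule card_image[symmetric]) (rule inj_on_subset[OF inj_on_shift], use assms(2) in auto)
    also have "(\<lambda>b. reduce p (b + x)) ` {b\<in>B. reduce p (b + x) \<in> B} = shift p x B \<inter> B"
      by (auto simp: shift_def)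
    finally show ?thesis .
  qed
  have flip: "reduce p (b - c - x) = 0 \<longleftrightarrow> reduce p (c - b + x) = 0" for b c
    using reduce_minus_eq_0_iff[of p "b - c - x"] by (simp add: algebra_simps)
  have cos_pair: "(\<Sum>v\<in>grid p. cos (angle p v (b - c)) * cos (angle p v x))
      = ((if reduce p (b - c + x) = 0 then real p ^ 3 else 0)
        + (if reduce p (c - b + x) = 0 then real p ^ 3 else 0)) / 2" for b c
  proof -
    have "cos (angle p v (b - c)) * cos (angle p v x)
        = (cos (angle p v (b - c + x)) + cos (angle p v (b - c - x))) / 2" for v
      by (simp add: angle_add[of p v "b - c"] angle_diff[of p v "b - c"] cos_times_cos)
    then show ?thesis
      by (simp only: sum_divide_distrib[symmetric] sum.distrib sum_cos_angle[OF assms(1)] flip)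
  qed
  have "(\<Sum>v\<in>grid p. spectral_weight p B v * cos (angle p v x))
      = (\<Sum>v\<in>grid p. \<Sum>b\<in>B. \<Sum>c\<in>B. cos (angle p v (b - c)) * cos (angle p v x))"
    by (simp add: spectral_weight_eq sum_distrib_right)
  also have "\<dots> = (\<Sum>b\<in>B. \<Sum>c\<in>B. \<Sum>v\<in>grid p. cos (angle p v (b - c)) * cos (angle p v x))"
    by (subst sum.swap) (rule sum.cong[OF refl], rule sum.swap)
  also have "\<dots> = ((\<Sum>b\<in>B. \<Sum>c\<in>B. if reduce p (b - c + x) = 0 then real p ^ 3 else 0)
      + (\<Sum>b\<in>B. \<Sum>c\<in>B. if reduce p (c - b + x) = 0 then real p ^ 3 else 0)) / 2"
    unfolding cos_pair by (simp only: sum_divide_distrib[symmetric] sum.distrib)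
  also have "(\<Sum>b\<in>B. \<Sum>c\<in>B. if reduce p (c - b + x) = 0 then real p ^ 3 else 0)
      = (\<Sum>b\<in>B. \<Sum>c\<in>B. if reduce p (b - c + x) = 0 then real p ^ 3 else 0)"
    by (rule sum.swap)
  finally show ?thesis
    by (simp add: inner)
qed

text \<open>
  Writes the escape count as a weighted average over characters with nonnegative weights. So a
  lower bound for a sum of escape counts can be proved for each nontrivial character separately.
\<close>
lemma sum_spectral_weight_one_minus_cos:
  assumes "p > 0" "B \<subseteq> grid p"
  shows "(\<Sum>v\<in>grid p. spectral_weight p B v * (1 - cos (angle p v x))) = real p ^ 3 * real (escape p B x)"
proof -
  have "real (card B) = real (card (shift p x B \<inter> B)) + real (escape p B x)"
    using card_shift_Int[OF assms(2), of x] by linarith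
  then show ?thesis
    by (simp add: right_diff_distrib sum_subtractf sum_spectral_weight[OF assms]
        sum_spectral_weight_cos[OF assms] distrib_left)
qed

text \<open>
  The closed form of the Dirichlet kernel; the left side telescopes.
\<close>
lemma sin_sum_cos_multiples:
  fixes \<theta> :: real
  shows "2 * sin (\<theta> / 2) * (\<Sum>k<h. cos (real k * \<theta>)) = sin ((real h - 1 / 2) * \<theta>) + sin (\<theta> / 2)"
proof (induction h)
  case (Suc h)
  have "2 * sin (\<theta> / 2) * cos (real h * \<theta>) = sin (\<theta> / 2 + real h * \<theta>) + sin (\<theta> / 2 - real h * \<theta>)"
    using sin_times_cos[of "\<theta> / 2" "real h * \<theta>"] by simp
  moreover have "sin (\<theta> / 2 - real h * \<theta>) = - sin ((real h - 1 / 2) * \<theta>)"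
    by (simp add: algebra_simps flip: sin_minus)
  moreover have "\<theta> / 2 + real h * \<theta> = (real (Suc h) - 1 / 2) * \<theta>"
    by (simp add: algebra_simps)
  ultimately show ?case
    using Suc by (simp add: distrib_left)
qed simp

lemma sin_ge_linear:
  assumes "0 \<le> x" "x \<le> pi / 2"
  shows "x / pi \<le> sin x"
proof (cases "x \<le> pi / 3")
  case True
  have "sin 0 - 0 / pi \<le> sin x - x / pi"
  proof (rule DERIV_nonneg_imp_nondecreasing[OF assms(1)])
    fix t assume t: "0 \<le> t" "t \<le> x"
    have "cos (pi / 3) \<le> cos t"
      using t True by (intro cos_monotone_0_pi_le) auto
    then have "1 / pi \<le> cos t"
      using pi_ge_two frac_le[of 1 1 2 pi] unfolding cos_60 by linarith
    then show "\<exists>y. ((\<lambda>x. sin x - x / pi) has_real_derivative y) (at t) \<and> 0 \<le> y"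
      by (intro exI[of _ "cos t - 1 / pi"]) (auto intro!: derivative_eq_intros)
  qed
  then show ?thesis
    by simp
next
  case False
  have "sin (pi / 6) \<le> sin x"
    using False assms by (intro sin_monotone_2pi_le) auto
  then have "1 / 2 \<le> sin x"
    by (simp add: sin_30)
  moreover have "x / pi \<le> 1 / 2"
    using assms by (simp add: field_simps)
  ultimately show ?thesis
    by linarith
qed

lemma abs_sin_half_angle_ge:
  assumes "p > 0" "r \<le> dot v x mod int p" "dot v x mod int p \<le> int p - r"
  shows "real_of_int r / real p \<le> \<bar>sin (angle p v x / 2)\<bar>"
proof -
  define \<rho> where "\<rho> = dot v x mod int p"
  define q where "q = dot v x div int p"
  define t where "t = pi * real_of_int \<rho> / real p"
  have "dot v x = q * int p + \<rho>"
    by (simp add: \<rho>_def q_def)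
  then have "angle p v x / 2 = t + pi * real_of_int q"
    using assms(1) by (simp add: angle_def t_def field_simps)
  then have "\<bar>sin (angle p v x / 2)\<bar> = \<bar>sin (t + pi * real_of_int q)\<bar>"
    by (simp only:)
  also have "\<dots> = \<bar>sin t\<bar>"
    by (simp add: sin_add abs_mult sin_npi_int cos_npi_int)
  finally have "\<bar>sin (angle p v x / 2)\<bar> = \<bar>sin t\<bar>" .
  moreover have "real_of_int r / real p \<le> sin t"
  proof (cases "t \<le> pi / 2")
    case True
    have "0 \<le> t"
      using assms(1) by (simp add: t_def \<rho>_def)
    moreover have "real_of_int r / real p \<le> t / pi"
      using assms by (simp add: t_def \<rho>_def divide_right_mono)
    ultimately show ?thesis
      using sin_ge_linear[OF _ True] by linarith
  next
    case False
    have "\<rho> \<le> int p"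
      using assms(1) by (simp add: \<rho>_def order_less_imp_le)
    then have "t \<le> pi"
      using assms(1) by (simp add: t_def field_simps)
    then have "(pi - t) / pi \<le> sin (pi - t)"
      using False by (intro sin_ge_linear) auto
    moreover have "real_of_int r \<le> real p - real_of_int \<rho>"
      using assms(3) unfolding \<rho>_def by linarith
    then have "real_of_int r / real p \<le> (pi - t) / pi"
      using assms(1) divide_right_mono[of "real_of_int r" "real p - real_of_int \<rho>" "real p"]
      by (simp add: t_def diff_divide_distrib)
    ultimately show ?thesis
      by simp
  qed
  ultimately show ?thesis
    by linarith
qed

text \<open>
  If the value of the character \<open>v\<close> at \<open>x\<close> is at least \<open>r\<close> steps away from \<open>1\<close>, its powers with exponents
  below \<open>h\<close> go around the circle once \<open>h\<close> exceeds \<open>p / r\<close>, and their real parts have a mean of at most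
  one half.
\<close>
lemma sum_one_minus_cos_multiples_ge:
  assumes "p > 0" "r > 0" "real p \<le> real r * (real h - 1)"
    and "int r \<le> dot v x mod int p" "dot v x mod int p \<le> int p - int r"
  shows "real h / 2 \<le> (\<Sum>k<h. 1 - cos (real k * angle p v x))"
proof -
  define s where "s = \<bar>sin (angle p v x / 2)\<bar>"
  define C where "C = (\<Sum>k<h. cos (real k * angle p v x))"
  have s: "real r / real p \<le> s"
    using abs_sin_half_angle_ge[OF assms(1,4,5)] by (simp add: s_def)
  then have "s > 0"
    using assms(1,2) by (smt (verit) divide_pos_pos of_nat_0_less_iff)
  have "2 * s * \<bar>C\<bar> = \<bar>sin ((real h - 1 / 2) * angle p v x) + sin (angle p v x / 2)\<bar>"
    unfolding sin_sum_cos_multiples[symmetric] s_def C_def by (simp add: abs_mult)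
  also have "\<dots> \<le> 1 + s"
    unfolding s_def using abs_sin_le_one[of "(real h - 1 / 2) * angle p v x"] by linarith
  finally have "\<bar>C\<bar> \<le> (1 + s) / (2 * s)"
    using \<open>s > 0\<close> by (simp add: field_simps)
  also have "\<dots> = 1 / s / 2 + 1 / 2"
    using \<open>s > 0\<close> by (simp add: field_simps)
  finally have bound: "\<bar>C\<bar> \<le> 1 / s / 2 + 1 / 2" .
  have "1 / s \<le> real p / real r"
    using frac_le[OF _ _ _ s, of 1 1] assms(1,2) by simp
  also have "\<dots> \<le> real h - 1"
    using assms(2,3) by (simp add: divide_le_eq mult.commute)
  finally have "1 / s / 2 \<le> (real h - 1) / 2"
    by (rule divide_right_mono) simp
  then have "\<bar>C\<bar> \<le> (real h - 1) / 2 + 1 / 2"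
    using bound by (meson add_right_mono order_trans)
  then have "C \<le> real h / 2"
    by (simp add: diff_divide_distrib)
  then show ?thesis
    by (simp add: sum_subtractf C_def)
qed

section \<open>Expansion by sequences without concentrated planes\<close>

text \<open>
  No affine plane contains more than \<open>4p\<close> terms. The integer \<open>\<delta>\<close> selects one plane of the parallel class
  with normal vector \<open>v\<close>. Planes that miss the origin have to be included, since a character that
  takes one value close to \<open>1\<close> on almost all terms would prevent expansion.
\<close>
definition plane_sparse :: "nat \<Rightarrow> (nat \<Rightarrow> vec) \<Rightarrow> nat set \<Rightarrow> bool" where
  "plane_sparse p a M \<longleftrightarrow>
     (\<forall>v \<delta>. reduce p v \<noteq> 0 \<longrightarrow> card {i\<in>M. int p dvd dot v (a i) - \<delta>} \<le> 4 * p)"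

lemma plane_sparseD: "plane_sparse p a M \<Longrightarrow> reduce p v \<noteq> 0 \<Longrightarrow> card {i\<in>M. int p dvd dot v (a i) - \<delta>} \<le> 4 * p"
  unfolding plane_sparse_def by blast

lemma plane_sparse_subset:
  assumes "plane_sparse p a M" "N \<subseteq> M" "finite M"
  shows "plane_sparse p a N"
  unfolding plane_sparse_def
proof (intro allI impI)
  fix v \<delta> assume "reduce p v \<noteq> 0"
  have "card {i\<in>N. int p dvd dot v (a i) - \<delta>} \<le> card {i\<in>M. int p dvd dot v (a i) - \<delta>}"
    using assms(2,3) by (intro card_mono) auto
  also have "\<dots> \<le> 4 * p"
    by (rule plane_sparseD[OF assms(1)]) fact
  finally show "card {i\<in>N. int p dvd dot v (a i) - \<delta>} \<le> 4 * p" .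
qed

text \<open>
  At most \<open>2r\<close> residues are excluded, and each of them corresponds to one affine plane.
\<close>
lemma card_small_residues_le:
  assumes "p > 0" "finite M" "plane_sparse p a M" "reduce p v \<noteq> 0"
  shows "card {i\<in>M. \<not> (int r \<le> dot v (a i) mod int p \<and> dot v (a i) mod int p \<le> int p - int r)} \<le> 8 * p * r"
proof -
  define D where "D = {0..<int r} \<union> {int p - int r<..<int p}"
  have finD: "finite D"
    by (simp add: D_def)
  have "card D \<le> 2 * r"
    using card_Un_le[of "{0..<int r}" "{int p - int r<..<int p}"] by (simp add: D_def)
  have "{i\<in>M. \<not> (int r \<le> dot v (a i) mod int p \<and> dot v (a i) mod int p \<le> int p - int r)}
      \<subseteq> (\<Union>\<delta>\<in>D. {i\<in>M. int p dvd dot v (a i) - \<delta>})" (is "?S \<subseteq> ?U")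
  proof
    fix i assume i: "i \<in> ?S"
    have "0 \<le> dot v (a i) mod int p" "dot v (a i) mod int p < int p"
      using assms(1) by auto
    then have "dot v (a i) mod int p \<in> D"
      using i by (auto simp: D_def)
    moreover have "int p dvd dot v (a i) - dot v (a i) mod int p"
      by (simp add: dvd_minus_mod)
    ultimately show "i \<in> ?U"
      using i by blast
  qed
  then have "card ?S \<le> card ?U"
    using assms(2) finD by (intro card_mono) auto
  also have "\<dots> \<le> (\<Sum>\<delta>\<in>D. card {i\<in>M. int p dvd dot v (a i) - \<delta>})"
    by (rule card_UN_le[OF finD])
  also have "\<dots> \<le> card D * (4 * p)"
    using sum_bounded_above[of D "\<lambda>\<delta>. card {i\<in>M. int p dvd dot v (a i) - \<delta>}" "4 * p"]
      plane_sparseD[OF assms(3,4)] by simp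
  also have "\<dots> \<le> 8 * p * r"
    using mult_le_mono1[OF \<open>card D \<le> 2 * r\<close>, of "4 * p"] by (simp add: mult_ac)
  finally show ?thesis .
qed

text \<open>
  Sum the escape counts of all multiples \<open>k (a i)\<close> with \<open>i \<in> M\<close> and \<open>k < h\<close>. If every term had a
  small escape count, subadditivity would make this sum small. On the other hand, for each
  nontrivial character at least half of the terms have a value away from \<open>1\<close>, so their
  multiples contribute a fixed proportion; and since \<open>B\<close> fills at most half of the group, the
  nontrivial characters carry at least half of the total weight.
\<close>
lemma exists_escape_of_plane_sparse:
  assumes p: "p > 0" and B: "B \<subseteq> grid p" "2 * card B \<le> p ^ 3"
    and M: "finite M" "plane_sparse p a M" "16 * p * r \<le> card M"
    and r: "r > 0" "real p \<le> real r * (real h - 1)"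
  shows "\<exists>i\<in>M. card B \<le> 8 * (h - 1) * escape p B (a i)"
proof (rule ccontr)
  assume "\<not> ?thesis"
  then have small: "8 * ((h - 1) * escape p B (a i)) < card B" if "i \<in> M" for i
    using that by (force simp: not_le)
  define m where "m = card M"
  have m: "m > 0"
    using M(3) p r(1) unfolding m_def by (intro Nat.gr0I) auto
  then have "M \<noteq> {}"
    by (auto simp: m_def)
  then have "card B > 0"
    using small by fastforce
  have "real h > 1"
    using r p by (smt (verit) mult_nonneg_nonpos of_nat_0_less_iff)
  then have h: "h \<ge> 2"
    by simp
  (* The sum of all these escape counts, scaled by the order of the group. *)
  define T where "T = (\<Sum>i\<in>M. \<Sum>k<h. real p ^ 3 * real (escape p B (scale (int k) (a i))))"
  have "T < (\<Sum>i\<in>M. \<Sum>k<h. real p ^ 3 * (real (card B) / 8))"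
    unfolding T_def
  proof (intro sum_strict_mono)
    fix i k assume i: "i \<in> M" and k: "k \<in> {..<h}"
    have "escape p B (scale (int k) (a i)) \<le> k * escape p B (a i)"
      by (rule escape_scale[OF B(1) p])
    also have "\<dots> \<le> (h - 1) * escape p B (a i)"
      using k by (intro mult_le_mono1) simp
    finally have "8 * escape p B (scale (int k) (a i)) < card B"
      using small[OF i] by linarith
    then show "real p ^ 3 * real (escape p B (scale (int k) (a i))) < real p ^ 3 * (real (card B) / 8)"
      using p by (intro mult_strict_left_mono) auto
  qed (use M(1) \<open>M \<noteq> {}\<close> h in \<open>auto simp: lessThan_empty_iff\<close>)
  then have upper: "T < real m * real h * (real p ^ 3 * real (card B)) / 8"
    by (simp add: m_def mult_ac)
  define F where "F v = (\<Sum>i\<in>M. \<Sum>k<h. 1 - cos (real k * angle p v (a i)))" for v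
  have "T = (\<Sum>i\<in>M. \<Sum>k<h. \<Sum>v\<in>grid p. spectral_weight p B v * (1 - cos (real k * angle p v (a i))))"
    unfolding T_def sum_spectral_weight_one_minus_cos[OF p B(1), symmetric] angle_scale by simp
  also have "\<dots> = (\<Sum>i\<in>M. \<Sum>v\<in>grid p. \<Sum>k<h. spectral_weight p B v * (1 - cos (real k * angle p v (a i))))"
    by (rule sum.cong[OF refl]) (rule sum.swap)
  also have "\<dots> = (\<Sum>v\<in>grid p. \<Sum>i\<in>M. \<Sum>k<h. spectral_weight p B v * (1 - cos (real k * angle p v (a i))))"
    by (rule sum.swap)
  also have "\<dots> = (\<Sum>v\<in>grid p. spectral_weight p B v * F v)"
    by (simp add: F_def sum_distrib_left)
  finally have T: "T = (\<Sum>v\<in>grid p. spectral_weight p B v * F v)" .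
  have F_nonneg: "F v \<ge> 0" for v
    unfolding F_def by (intro sum_nonneg) simp
  have F_ge: "real m * real h / 4 \<le> F v" if "v \<in> grid p" "v \<noteq> 0" for v
  proof -
    define G where "G = {i\<in>M. int r \<le> dot v (a i) mod int p \<and> dot v (a i) mod int p \<le> int p - int r}"
    have "reduce p v \<noteq> 0"
      using that by (simp add: reduce_grid)
    moreover have "M - G = {i\<in>M. \<not> (int r \<le> dot v (a i) mod int p \<and> dot v (a i) mod int p \<le> int p - int r)}"
      by (auto simp: G_def)
    ultimately have "card (M - G) \<le> 8 * p * r"
      using card_small_residues_le[OF p M(1,2), of v r] by simp
    moreover have "card M = card G + card (M - G)"
      using M(1) card_Int_Diff[of M G] by (simp add: G_def Int_def)
    ultimately have "m \<le> 2 * card G"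
      using M(3) unfolding m_def by linarith
    have "real m * real h / 4 \<le> real (card G) * (real h / 2)"
      using mult_right_mono[of "real m" "2 * real (card G)" "real h"] \<open>m \<le> 2 * card G\<close> by (simp add: mult_ac)
    also have "\<dots> = (\<Sum>i\<in>G. real h / 2)"
      by simp
    also have "\<dots> \<le> (\<Sum>i\<in>G. \<Sum>k<h. 1 - cos (real k * angle p v (a i)))"
      by (intro sum_mono sum_one_minus_cos_multiples_ge[OF p r]) (auto simp: G_def)
    also have "\<dots> \<le> F v"
      unfolding F_def using M(1) by (intro sum_mono2) (auto simp: G_def intro!: sum_nonneg)
    finally show ?thesis .
  qed
  have zero: "0 \<in> grid p"
    using p by (simp add: grid_def zero_prod_def)
  have "real p ^ 3 * real (card B) * (real m * real h) / 8
      \<le> (real p ^ 3 * real (card B) - (real (card B))\<^sup>2) * (real m * real h / 4)"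
  proof -
    have "2 * real (card B) \<le> real p ^ 3"
      using B(2) by (metis of_nat_le_iff of_nat_mult of_nat_numeral of_nat_power)
    then have "real (card B) * (2 * real (card B)) \<le> real (card B) * real p ^ 3"
      by (intro mult_left_mono) auto
    then have "real p ^ 3 * real (card B) / 2 \<le> real p ^ 3 * real (card B) - (real (card B))\<^sup>2"
      by (simp add: power2_eq_square mult_ac)
    from mult_right_mono[OF this, of "real m * real h / 4"] show ?thesis
      by simp
  qed
  also have "real p ^ 3 * real (card B) - (real (card B))\<^sup>2 = (\<Sum>v\<in>grid p - {0}. spectral_weight p B v)"
    using sum.remove[OF finite_grid zero, of "spectral_weight p B"]
    by (simp add: sum_spectral_weight[OF p B(1)] spectral_weight_zero)
  also have "\<dots> * (real m * real h / 4) = (\<Sum>v\<in>grid p - {0}. spectral_weight p B v * (real m * real h / 4))"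
    by (rule sum_distrib_right)
  also have "\<dots> \<le> (\<Sum>v\<in>grid p - {0}. spectral_weight p B v * F v)"
    using F_ge by (intro sum_mono mult_left_mono spectral_weight_nonneg) auto
  also have "\<dots> \<le> T"
    unfolding T by (intro sum_mono2) (auto intro!: mult_nonneg_nonneg spectral_weight_nonneg F_nonneg)
  finally show False
    using upper by (simp add: mult_ac)
qed

section \<open>Growth of the set of subset sums\<close>

definition subset_sums :: "nat \<Rightarrow> (nat \<Rightarrow> vec) \<Rightarrow> nat set \<Rightarrow> vec set" where
  "subset_sums p a I = (\<lambda>J. reduce p (\<Sum>j\<in>J. a j)) ` Pow I"

lemma subset_sums_grid: "p > 0 \<Longrightarrow> subset_sums p a I \<subseteq> grid p"
  by (auto simp: subset_sums_def reduce_in_grid)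

lemma card_subset_sums_pos:
  assumes "p > 0"
  shows "card (subset_sums p a I) > 0"
proof -
  have "finite (subset_sums p a I)"
    using finite_subset[OF subset_sums_grid[OF assms]] by simp
  moreover have "subset_sums p a I \<noteq> {}"
    by (auto simp: subset_sums_def)
  ultimately show ?thesis
    by (simp add: card_gt_0_iff)
qed

lemma subset_sums_insert:
  assumes "finite I" "i \<notin> I"
  shows "subset_sums p a (insert i I) = subset_sums p a I \<union> shift p (a i) (subset_sums p a I)"
proof -
  have "reduce p (\<Sum>j\<in>insert i J. a j) = reduce p (reduce p (\<Sum>j\<in>J. a j) + a i)" if "J \<in> Pow I" for J
  proof -
    have "finite J" "i \<notin> J"
      using that assms finite_subset[of J I] by auto
    then show ?thesis
      by (simp add: reduce_add_right add.commute)
  qed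
  then have "(\<lambda>J. reduce p (\<Sum>j\<in>insert i J. a j)) ` Pow I = shift p (a i) (subset_sums p a I)"
    unfolding shift_def subset_sums_def image_image by (intro image_cong) auto
  then show ?thesis
    unfolding subset_sums_def Pow_insert image_Un by (simp add: image_image)
qed

lemma card_subset_sums_insert:
  assumes "p > 0" "finite I" "i \<notin> I"
  shows "card (subset_sums p a (insert i I)) = card (subset_sums p a I) + escape p (subset_sums p a I) (a i)"
proof -
  define S where "S = subset_sums p a I"
  have "finite S" "finite (shift p (a i) S)"
    using finite_subset[OF subset_sums_grid[OF assms(1)]] by (simp_all add: S_def shift_def)
  moreover have "subset_sums p a (insert i I) = S \<union> (shift p (a i) S - S)"
    by (simp add: subset_sums_insert[OF assms(2,3)] S_def)
  ultimately show ?thesis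
    by (simp add: card_Un_disjoint escape_def S_def[symmetric] del: Un_Diff_cancel)
qed

lemma plane_sparse_not_in_plane:
  assumes "plane_sparse p a N" "4 * p < card N" "reduce p v \<noteq> 0"
  shows "\<exists>i\<in>N. \<not> int p dvd dot v (a i)"
proof (rule ccontr)
  assume "\<not> ?thesis"
  then have "{i\<in>N. int p dvd dot v (a i) - 0} = N"
    by auto
  then show False
    using plane_sparseD[OF assms(1,3), of 0] assms(2) by simp
qed

text \<open>
  Three terms are chosen one after the other outside a plane through the origin: the first with a
  nonzero first coordinate, the second with a nonzero leading minor together with the first, and
  the third outside the plane spanned by the first two, whose normal vector is their cross product.
\<close>
lemma plane_sparse_contains_basis:
  assumes p: "prime p" and N: "plane_sparse p a N" "4 * p < card N"
  shows "\<exists>i\<in>N. \<exists>j\<in>N. \<exists>k\<in>N. \<forall>d1 d2 d3. \<bar>d1\<bar> < int p \<longrightarrow> \<bar>d2\<bar> < int p \<longrightarrow> \<bar>d3\<bar> < int p \<longrightarrow>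
    reduce p (scale d1 (a i) + scale d2 (a j) + scale d3 (a k)) = 0 \<longrightarrow> d1 = 0 \<and> d2 = 0 \<and> d3 = 0"
proof -
  have pr: "prime (int p)"
    using p by simp
  have "reduce p (1, 0, 0) \<noteq> 0"
    using prime_gt_1_nat[OF p] by (simp add: reduce_eq_0_iff del: reduce.simps)
  then obtain i where i: "i \<in> N" "\<not> int p dvd dot (1, 0, 0) (a i)"
    using plane_sparse_not_in_plane[OF N] by blast
  obtain x1 y1 z1 where ai: "a i = (x1, y1, z1)"
    by (cases "a i")
  have x1: "\<not> int p dvd x1"
    using i(2) by (simp add: ai)
  then have "reduce p (- y1, x1, 0) \<noteq> 0"
    by (simp add: reduce_eq_0_iff del: reduce.simps)
  then obtain j where j: "j \<in> N" "\<not> int p dvd dot (- y1, x1, 0) (a j)"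
    using plane_sparse_not_in_plane[OF N] by blast
  obtain x2 y2 z2 where aj: "a j = (x2, y2, z2)"
    by (cases "a j")
  have minor: "\<not> int p dvd x1 * y2 - y1 * x2"
    using j(2) by (simp add: aj)
  define c1 c2 where "c1 = y1 * z2 - z1 * y2" and "c2 = z1 * x2 - x1 * z2"
  have "reduce p (c1, c2, x1 * y2 - y1 * x2) \<noteq> 0"
    using minor by (simp add: reduce_eq_0_iff del: reduce.simps)
  then obtain k where k: "k \<in> N" "\<not> int p dvd dot (c1, c2, x1 * y2 - y1 * x2) (a k)"
    using plane_sparse_not_in_plane[OF N] by blast
  obtain x3 y3 z3 where ak: "a k = (x3, y3, z3)"
    by (cases "a k")
  define D where "D = c1 * x3 + c2 * y3 + (x1 * y2 - y1 * x2) * z3"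
  have det: "\<not> int p dvd D"
    using k(2) by (simp add: ak D_def)
  have small: "d = 0" if "int p dvd d * q" "\<not> int p dvd q" "\<bar>d\<bar> < int p" for d q
  proof -
    have "int p dvd d"
      using that(1,2) prime_dvd_multD[OF pr] by blast
    then show "d = 0"
      using that(3) dvd_imp_le_int[of d "int p"] by fastforce
  qed
  have "d1 = 0 \<and> d2 = 0 \<and> d3 = 0"
    if d: "\<bar>d1\<bar> < int p" "\<bar>d2\<bar> < int p" "\<bar>d3\<bar> < int p"
      and zero: "reduce p (scale d1 (a i) + scale d2 (a j) + scale d3 (a k)) = 0" for d1 d2 d3
  proof -
    have xyz: "int p dvd d1 * x1 + d2 * x2 + d3 * x3" "int p dvd d1 * y1 + d2 * y2 + d3 * y3"
        "int p dvd d1 * z1 + d2 * z2 + d3 * z3"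
      using zero unfolding ai aj ak by (simp_all add: reduce_eq_0_iff del: reduce.simps)
    have "int p dvd c1 * (d1 * x1 + d2 * x2 + d3 * x3) + c2 * (d1 * y1 + d2 * y2 + d3 * y3)
        + (x1 * y2 - y1 * x2) * (d1 * z1 + d2 * z2 + d3 * z3)"
      by (rule dvd_add[OF dvd_add[OF dvd_mult[OF xyz(1)] dvd_mult[OF xyz(2)]] dvd_mult[OF xyz(3)]])
    also have "\<dots> = d3 * D"
      by (simp add: c1_def c2_def D_def algebra_simps)
    finally have d3: "d3 = 0"
      using small det d(3) by blast
    have "int p dvd x1 * (d1 * y1 + d2 * y2 + d3 * y3) - y1 * (d1 * x1 + d2 * x2 + d3 * x3)"
      by (rule dvd_diff[OF dvd_mult[OF xyz(2)] dvd_mult[OF xyz(1)]])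
    also have "\<dots> = d2 * (x1 * y2 - y1 * x2)"
      by (simp add: d3 algebra_simps)
    finally have d2: "d2 = 0"
      using small minor d(2) by blast
    have "int p dvd d1 * x1"
      using xyz(1) by (simp add: d2 d3)
    then have "d1 = 0"
      using small x1 d(1) by blast
    then show ?thesis
      using d2 d3 by simp
  qed
  then show ?thesis
    using i(1) j(1) k(1) by blast
qed

text \<open>
  The arithmetic of one step: \<open>32768 = 32\<^sup>3\<close>, and an increment of \<open>14 b / (3 (t + 1))\<close> keeps the size
  above \<open>(t / 32)\<^sup>3\<close>, because a cube only needs the smaller relative increment of about \<open>3 / t\<close>.
\<close>
lemma cubic_growth_step:
  fixes t b e :: nat
  assumes "32 \<le> t" "t ^ 3 \<le> 32768 * b" "14 * b \<le> 3 * (t + 1) * e"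
  shows "(t + 1) ^ 3 \<le> 32768 * (b + e)"
proof -
  have "5 * t ^ 3 = 5 * t * t * t"
    by (simp add: power3_eq_cube)
  have tt: "32 * t \<le> t * t"
    using mult_le_mono1[OF assms(1), of t] .
  have ttt: "32 * (t * t) \<le> t * (t * t)"
    using mult_le_mono1[OF assms(1), of "t * t"] .
  have "3 * (t + 1) ^ 4 = t ^ 3 * (3 * t) + (12 * (t * (t * t)) + 18 * (t * t) + 12 * t + 3)"
    by (simp add: power4_eq_xxxx power3_eq_cube algebra_simps)
  also have "\<dots> \<le> t ^ 3 * (3 * t) + 17 * (t * (t * t))"
    using tt ttt assms(1) by linarith
  also have "\<dots> = t ^ 3 * (3 * t + 17)"
    by (simp add: power3_eq_cube algebra_simps)
  also have "\<dots> \<le> (32768 * b) * (3 * t + 17)"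
    using assms(2) by (rule mult_le_mono1)
  also have "\<dots> = 32768 * (3 * (t + 1) * b + 14 * b)"
    by (simp add: algebra_simps)
  also have "\<dots> \<le> 32768 * (3 * (t + 1) * b + 3 * (t + 1) * e)"
    by (intro mult_le_mono2 add_left_mono assms(3))
  also have "\<dots> = (3 * (t + 1)) * (32768 * (b + e))"
    by (simp add: algebra_simps)
  finally have "3 * (t + 1) ^ 4 \<le> (3 * (t + 1)) * (32768 * (b + e))" .
  moreover have "3 * (t + 1) ^ 4 = (3 * (t + 1)) * (t + 1) ^ 3"
    by (simp only: power4_eq_xxxx power3_eq_cube mult.assoc)
  ultimately have "(3 * (t + 1)) * (t + 1) ^ 3 \<le> (3 * (t + 1)) * (32768 * (b + e))"
    by (simp only:)
  then show ?thesis
    by (simp only: mult_le_cancel1) simp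
qed

text \<open>
  While the set of subset sums is small, any basis of remaining terms expands it, as in the integer
  lattice; after \<open>t\<close> steps it has at least \<open>(t / 32)\<^sup>3\<close> elements. With \<open>t\<close> near \<open>p / 4\<close> this is a
  fixed proportion of the group.
\<close>
lemma subset_sums_cubic_growth:
  assumes p: "prime p" and M: "finite M" "plane_sparse p a M" "5 * p \<le> card M" and "t \<le> p div 4"
  shows "\<exists>I\<subseteq>M. card I = t \<and> t ^ 3 \<le> 32768 * card (subset_sums p a I)"
  using assms(5)
proof (induction t)
  case 0
  then show ?case
    by (intro exI[of _ "{}"]) simp
next
  case (Suc t)
  then obtain I where I: "I \<subseteq> M" "card I = t" "t ^ 3 \<le> 32768 * card (subset_sums p a I)"
    by auto
  have p0: "p > 0"
    using prime_gt_0_nat p by blast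
  have finI: "finite I"
    using finite_subset[OF I(1) M(1)] .
  define b where "b = card (subset_sums p a I)"
  have b: "b > 0" "t ^ 3 \<le> 32768 * b"
    using card_subset_sums_pos[OF p0] I(3) by (auto simp: b_def)
  have N: "finite (M - I)" "plane_sparse p a (M - I)" "4 * p < card (M - I)"
    using M plane_sparse_subset[OF M(2), of "M - I"] card_Diff_subset[OF finI I(1)] I(2) Suc.prems p0 by auto
  have extend: ?case if i: "i \<in> M - I" "(t + 1) ^ 3 \<le> 32768 * (b + escape p (subset_sums p a I) (a i))" for i
    using i I(1,2) finI card_subset_sums_insert[OF p0 finI, of i a]
    by (intro exI[of _ "insert i I"]) (auto simp: b_def)
  show ?case
  proof (cases "(t + 1) ^ 3 \<le> 32768 * b")
    case True
    have "M - I \<noteq> {}"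
      using N(3) by (metis card.empty not_less_zero)
    then obtain i where "i \<in> M - I"
      by blast
    then show ?thesis
      using extend True by simp
  next
    case False
    have "\<not> t + 1 \<le> 32"
    proof
      assume "t + 1 \<le> 32"
      then have "(t + 1) ^ 3 \<le> 32 ^ 3"
        by (rule power_mono) simp
      then show False
        using False b(1) by simp
    qed
    then have t: "32 \<le> t"
      by simp
    (* The set has fewer than ((t + 1) / 32)^3 elements here, hence h^3 is at least 8 times its size. *)
    define h where "h = (t + 1) div 16 + 1"
    have h: "0 < h" "h \<le> p" "16 * (h - 1) \<le> t + 1" "t + 1 \<le> 16 * h"
      using Suc.prems t by (auto simp: h_def)
    have "(t + 1) ^ 3 \<le> (16 * h) ^ 3"
      using h(4) by (rule power_mono) simp
    then have h3: "8 * card (subset_sums p a I) \<le> h ^ 3"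
      using False by (simp add: b_def power_mult_distrib)
    obtain i j k where ijk: "i \<in> M - I" "j \<in> M - I" "k \<in> M - I"
      and indep: "\<forall>d1 d2 d3. \<bar>d1\<bar> < int p \<longrightarrow> \<bar>d2\<bar> < int p \<longrightarrow> \<bar>d3\<bar> < int p \<longrightarrow>
        reduce p (scale d1 (a i) + scale d2 (a j) + scale d3 (a k)) = 0 \<longrightarrow> d1 = 0 \<and> d2 = 0 \<and> d3 = 0"
      using plane_sparse_contains_basis[OF p N(2,3)] by blast
    obtain e where "e \<in> {a i, a j, a k}" and e: "7 * b \<le> 24 * (h - 1) * escape p (subset_sums p a I) e"
      unfolding b_def
      using exists_escape_of_basis[OF subset_sums_grid[OF p0] p0 h(1,2) h3, of "a i" "a j" "a k"] indep
      by blast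
    then obtain l where l: "l \<in> M - I" "7 * b \<le> 24 * (h - 1) * escape p (subset_sums p a I) (a l)"
      using ijk by blast
    define g where "g = escape p (subset_sums p a I) (a l)"
    have "14 * b \<le> 3 * (16 * (h - 1)) * g"
      using l(2) by (simp add: g_def)
    also have "\<dots> \<le> 3 * (t + 1) * g"
      using h(3) by (intro mult_le_mono) auto
    finally have "(t + 1) ^ 3 \<le> 32768 * (b + g)"
      by (rule cubic_growth_step[OF t b(2)])
    then show ?thesis
      using extend[OF l(1)] by (simp add: g_def)
  qed
qed

text \<open>
  The preceding expansion lemma with \<open>r = 1000\<close>: at least \<open>16000 p\<close> terms spread over the planes
  increase the size by a factor of \<open>1 + 100 / p\<close>, where a basis alone would only give a factor
  \<open>1 + c / p\<close> with a small constant \<open>c\<close>.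
\<close>
lemma plane_sparse_expansion:
  assumes p: "6788 < p" and B: "B \<subseteq> grid p" "2 * card B \<le> p ^ 3"
    and M: "finite M" "plane_sparse p a M" "16000 * p \<le> card M"
  shows "\<exists>i\<in>M. 100 * card B \<le> p * escape p B (a i)"
proof -
  define h where "h = p div 1000 + 2"
  have "p \<le> 1000 * (h - 1)"
    by (simp add: h_def)
  then have "real p \<le> real (1000 * (h - 1))"
    by (simp only: of_nat_le_iff)
  then have hp: "real p \<le> real 1000 * (real h - 1)"
    by (simp add: h_def)
  have "\<exists>i\<in>M. card B \<le> 8 * (h - 1) * escape p B (a i)"
    by (rule exists_escape_of_plane_sparse[OF _ B M(1,2) _ _ hp]) (use p M(3) in auto)
  then obtain i where i: "i \<in> M" "card B \<le> 8 * (h - 1) * escape p B (a i)"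
    by blast
  have "100 * card B \<le> (800 * (h - 1)) * escape p B (a i)"
    using i(2) by simp
  also have "\<dots> \<le> p * escape p B (a i)"
    using p by (intro mult_le_mono1) (simp add: h_def)
  finally show ?thesis
    using i(1) by blast
qed

text \<open>
  Once the size is a fixed proportion of the group, each further term multiplies it by \<open>1 + 100 / p\<close>
  until half of the group is reached.
\<close>
lemma subset_sums_exponential_growth:
  assumes p: "6788 < p" and M: "finite M" "plane_sparse p a M" "16000 * p + card I0 + s \<le> card M" and "I0 \<subseteq> M"
  shows "\<exists>I\<subseteq>M. card I \<le> card I0 + s \<and> (p ^ 3 < 2 * card (subset_sums p a I) \<or>
    (1 + 100 / real p) ^ s * real (card (subset_sums p a I0)) \<le> real (card (subset_sums p a I)))"
  using M(3)
proof (induction s)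
  case 0
  then show ?case
    using assms(5) by (intro exI[of _ I0]) simp
next
  case (Suc s)
  then obtain I where I: "I \<subseteq> M" "card I \<le> card I0 + s" "p ^ 3 < 2 * card (subset_sums p a I) \<or>
    (1 + 100 / real p) ^ s * real (card (subset_sums p a I0)) \<le> real (card (subset_sums p a I))"
    by auto
  show ?case
  proof (cases "p ^ 3 < 2 * card (subset_sums p a I)")
    case True
    then show ?thesis
      using I by (intro exI[of _ I]) simp
  next
    case False
    define S where "S = subset_sums p a I"
    have p0: "p > 0"
      using p by simp
    have finI: "finite I"
      using finite_subset[OF I(1) M(1)] .
    have "16000 * p \<le> card (M - I)"
      using card_Diff_subset[OF finI I(1)] I(2) Suc.prems by simp
    moreover have "plane_sparse p a (M - I)" "finite (M - I)"
      using plane_sparse_subset[OF M(2)] M(1) by auto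
    ultimately obtain i where i: "i \<in> M - I" "100 * card S \<le> p * escape p S (a i)"
      using plane_sparse_expansion[OF p subset_sums_grid[OF p0]] False unfolding S_def by (meson not_less)
    have "100 * real (card S) \<le> real p * real (escape p S (a i))"
      using i(2) by (metis of_nat_le_iff of_nat_mult of_nat_numeral)
    then have "100 / real p * real (card S) \<le> real (escape p S (a i))"
      using p0 by (simp add: divide_le_eq mult.commute)
    then have "(1 + 100 / real p) * real (card S) \<le> real (card (subset_sums p a (insert i I)))"
      using card_subset_sums_insert[OF p0 finI, of i a] i(1) by (simp add: S_def distrib_right)
    moreover have "(1 + 100 / real p) ^ s * real (card (subset_sums p a I0)) \<le> real (card S)"
      using I(3) False by (simp add: S_def)
    then have "(1 + 100 / real p) * ((1 + 100 / real p) ^ s * real (card (subset_sums p a I0)))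
        \<le> (1 + 100 / real p) * real (card S)"
      by (intro mult_left_mono) simp_all
    ultimately have "(1 + 100 / real p) ^ Suc s * real (card (subset_sums p a I0))
        \<le> real (card (subset_sums p a (insert i I)))"
      by (simp only: power_Suc mult.assoc)
    moreover have "insert i I \<subseteq> M" "card (insert i I) \<le> card I0 + Suc s"
      using I(1,2) i(1) card_insert_le_m1[of "card I0 + Suc s" I i] by auto
    ultimately show ?thesis
      by blast
  qed
qed

text \<open>
  The left side is \<open>129\<^sup>3\<close>. After \<open>p / 80\<close> steps of the exponential growth the size is multiplied by
  at least \<open>2.23\<close>, by Bernoulli's inequality, and \<open>p / 4\<close> steps contain \<open>20\<close> such periods.
\<close>
lemma exponential_beats_cubic:
  assumes "6788 < p"
  shows "2146689 < (1 + 100 / real p) ^ (p div 4)"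
proof -
  define q where "q = p div 80"
  have "80 * q + 79 \<ge> p"
    by (simp add: q_def)
  then have "80 * real q + 79 \<ge> real p"
    by linarith
  moreover have "real p > 6788"
    using assms by simp
  ultimately have "100 * real q \<ge> 123 / 100 * real p"
    by linarith
  then have "123 / 100 \<le> real q * (100 / real p)"
    using assms by (simp add: field_simps)
  also have "1 + real q * (100 / real p) \<le> (1 + 100 / real p) ^ q"
    by (rule Bernoulli_inequality) (simp add: order_trans[of "-1" 0])
  finally have "223 / 100 \<le> (1 + 100 / real p) ^ q"
    by simp
  then have "(223 / 100) ^ 20 \<le> ((1 + 100 / real p) ^ q) ^ 20"
    by (rule power_mono) simp
  also have "\<dots> = (1 + 100 / real p) ^ (q * 20)"
    by (simp add: power_mult)
  also have "\<dots> \<le> (1 + 100 / real p) ^ (p div 4)"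
    by (rule power_increasing) (auto simp: q_def)
  finally have "(223 / 100) ^ 20 \<le> (1 + 100 / real p) ^ (p div 4)" .
  moreover have "(2146689 :: real) < (223 / 100) ^ 20"
    by (simp add: power_divide)
  ultimately show ?thesis
    by linarith
qed

text \<open>
  Cubic growth for \<open>p / 4\<close> steps gives at least \<open>(p / 129)\<^sup>3\<close> sums, and another \<open>p / 4\<close> steps of
  exponential growth lead beyond half of the group.
\<close>
lemma subset_sums_fill_half:
  assumes p: "prime p" "6788 < p" and M: "finite M" "plane_sparse p a M" "17000 * p \<le> card M"
  shows "\<exists>I\<subseteq>M. card I \<le> 2 * (p div 4) \<and> p ^ 3 < 2 * card (subset_sums p a I)"
proof -
  define t where "t = p div 4"
  obtain I0 where I0: "I0 \<subseteq> M" "card I0 = t" "t ^ 3 \<le> 32768 * card (subset_sums p a I0)"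
    using subset_sums_cubic_growth[OF p(1) M(1,2), of t] M(3) by (auto simp: t_def)
  have "16000 * p + card I0 + t \<le> card M"
    using M(3) I0(2) by (simp add: t_def)
  then obtain I where I: "I \<subseteq> M" "card I \<le> card I0 + t" "p ^ 3 < 2 * card (subset_sums p a I) \<or>
    (1 + 100 / real p) ^ t * real (card (subset_sums p a I0)) \<le> real (card (subset_sums p a I))"
    using subset_sums_exponential_growth[OF p(2) M(1,2) _ I0(1)] by blast
  have "p ^ 3 < 2 * card (subset_sums p a I)"
  proof (rule ccontr)
    assume small: "\<not> ?thesis"
    have p0: "real p > 0"
      using p(2) by simp
    define b where "b = real (card (subset_sums p a I0))"
    have "p \<le> 4 * t + 3"
      by (simp add: t_def)
    then have "128 * p \<le> 129 * (4 * t)"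
      using p(2) by linarith
    then have "real p \<le> 129 * (real t / 32)"
      by linarith
    then have "real p ^ 3 \<le> (129 * (real t / 32)) ^ 3"
      by (rule power_mono) simp
    also have "\<dots> = 2146689 * (real (t ^ 3) / 32768)"
      by (simp add: power_mult_distrib power_divide)
    also have "\<dots> \<le> 2146689 * b"
      using I0(3) unfolding b_def by linarith
    also have "\<dots> \<le> (1 + 100 / real p) ^ t * b"
      using exponential_beats_cubic[OF p(2)] unfolding b_def t_def by (intro mult_right_mono) auto
    also have "\<dots> \<le> real (card (subset_sums p a I))"
      using I(3) small by (simp add: b_def)
    also have "\<dots> \<le> real p ^ 3 / 2"
    proof -
      have "real (2 * card (subset_sums p a I)) \<le> real (p ^ 3)"
        using small by (simp only: of_nat_le_iff not_less)
      then show ?thesis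
        by simp
    qed
    finally show False
      using p0 by simp
  qed
  then show ?thesis
    using I I0(2) by (intro exI[of _ I]) (simp add: t_def)
qed

section \<open>Short zero sums in dimension three: large primes\<close>

lemma sum_triple:
  "(\<Sum>i\<in>I. (x i, y i, z i)) = ((\<Sum>i\<in>I. x i), (\<Sum>i\<in>I. y i), (\<Sum>i\<in>I. z i) :: int)"
  for x y z :: "nat \<Rightarrow> int"
  by (induction I rule: infinite_finite_induct) (auto simp: zero_prod_def)

text \<open>
  Two sets of residue vectors that each fill more than half of the group have every vector as a sum. Subset sums
  of two disjoint parts of the sequence are two such sets, and together they represent the negative
  of one further term \<open>a i\<close>. Adding that term gives a zero sum, which is non-empty in any case; its
  length is at most \<open>1 + 4 (p div 4) \<le> p\<close>, since \<open>p\<close> is odd.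
\<close>
lemma exists_short_zero_sum_of_plane_sparse:
  assumes p: "prime p" "6788 < p" and M: "finite M" "plane_sparse p a M" "18000 * p \<le> card M"
  shows "\<exists>I\<subseteq>M. I \<noteq> {} \<and> card I \<le> p \<and> reduce p (\<Sum>i\<in>I. a i) = 0"
proof -
  have p0: "p > 0"
    using p(2) by simp
  obtain I1 where I1: "I1 \<subseteq> M" "card I1 \<le> 2 * (p div 4)" "p ^ 3 < 2 * card (subset_sums p a I1)"
    using subset_sums_fill_half[OF p M(1,2)] M(3) by auto
  have fin1: "finite I1"
    using finite_subset[OF I1(1) M(1)] .
  have "17000 * p \<le> card (M - I1)"
    using card_Diff_subset[OF fin1 I1(1)] I1(2) M(3) by simp
  then obtain I2 where I2: "I2 \<subseteq> M - I1" "card I2 \<le> 2 * (p div 4)" "p ^ 3 < 2 * card (subset_sums p a I2)"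
    using subset_sums_fill_half[OF p _ plane_sparse_subset[OF M(2)], of "M - I1"] M(1) by auto
  have fin2: "finite I2"
    using finite_subset[OF I2(1)] M(1) by simp
  have "card (I1 \<union> I2) < card M"
    using card_Un_le[of I1 I2] I1(2) I2(2) M(3) p(2) by linarith
  then have "\<not> M \<subseteq> I1 \<union> I2"
    using card_mono[of "I1 \<union> I2" M] fin1 fin2 by auto
  then obtain i where i: "i \<in> M" "i \<notin> I1" "i \<notin> I2"
    by blast
  define neg where "neg c = reduce p (- (c + a i))" for c
  have "inj_on neg (grid p)"
  proof (rule inj_onI)
    fix b c assume bc: "b \<in> grid p" "c \<in> grid p" "neg b = neg c"
    then have "reduce p (c - b) = 0"
      unfolding neg_def reduce_eq_iff[of p "- (b + a i)"] by (simp add: algebra_simps)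
    then have "reduce p c = reduce p b"
      by (simp add: reduce_eq_iff)
    then show "b = c"
      using bc by (simp add: reduce_grid)
  qed
  then have "card (neg ` subset_sums p a I2) = card (subset_sums p a I2)"
    by (intro card_image) (rule inj_on_subset[OF _ subset_sums_grid[OF p0]])
  moreover have "subset_sums p a I1 \<union> neg ` subset_sums p a I2 \<subseteq> grid p"
    using subset_sums_grid[OF p0] by (auto simp: neg_def reduce_in_grid p0)
  then have "card (subset_sums p a I1 \<union> neg ` subset_sums p a I2) \<le> p ^ 3"
    using card_mono[OF finite_grid] card_grid by metis
  ultimately have "subset_sums p a I1 \<inter> neg ` subset_sums p a I2 \<noteq> {}"
    using I1(3) I2(3) card_Un_disjoint[of "subset_sums p a I1" "neg ` subset_sums p a I2"]
      finite_subset[OF subset_sums_grid[OF p0] finite_grid] by force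
  then obtain s t where "s \<in> subset_sums p a I1" "t \<in> subset_sums p a I2" "s = neg t"
    by blast
  then obtain J1 J2 where J: "J1 \<subseteq> I1" "J2 \<subseteq> I2"
      "reduce p (\<Sum>j\<in>J1. a j) = neg (reduce p (\<Sum>j\<in>J2. a j))"
    unfolding subset_sums_def by blast
  define I where "I = insert i (J1 \<union> J2)"
  have finJ: "finite J1" "finite J2"
    using finite_subset[OF J(1) fin1] finite_subset[OF J(2) fin2] .
  have disj: "J1 \<inter> J2 = {}" "i \<notin> J1 \<union> J2"
    using I2(1) J i by auto
  have "neg (reduce p (\<Sum>j\<in>J2. a j)) = reduce p (- ((\<Sum>j\<in>J2. a j) + a i))"
    unfolding neg_def reduce_eq_iff[of p "- (reduce p (\<Sum>j\<in>J2. a j) + a i)"]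
    using reduce_add_right[of p "\<Sum>j\<in>J2. a j" "- (\<Sum>j\<in>J2. a j)"]
    by (simp add: algebra_simps reduce_eq_iff[symmetric] reduce_idem)
  then have "reduce p ((\<Sum>j\<in>J1. a j) + (\<Sum>j\<in>J2. a j) + a i) = 0"
    using J(3) by (simp add: reduce_eq_iff algebra_simps)
  moreover have "(\<Sum>j\<in>I. a j) = (\<Sum>j\<in>J1. a j) + (\<Sum>j\<in>J2. a j) + a i"
    using finJ disj by (simp add: I_def sum.union_disjoint add.commute)
  moreover have "card I \<le> p"
  proof -
    have "odd p"
      using prime_odd_nat[OF p(1)] p(2) by simp
    then have "4 * (p div 4) < p"
      by presburger
    moreover have "card I \<le> 1 + (card J1 + card J2)"
      using finJ card_Un_le[of J1 J2] by (simp add: I_def card_insert_if)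
    moreover have "card J1 \<le> card I1" "card J2 \<le> card I2"
      using card_mono[OF fin1 J(1)] card_mono[OF fin2 J(2)] .
    ultimately show ?thesis
      using I1(2) I2(2) by linarith
  qed
  moreover have "I \<subseteq> M" "I \<noteq> {}"
    using i(1) I1(1) I2(1) J by (auto simp: I_def)
  ultimately show ?thesis
    by (intro exI[of _ I]) simp
qed

lemma zero_sum_of_length_pair:
  fixes x y :: "nat \<Rightarrow> int"
  assumes "prime p" "p \<noteq> 2" "finite M" "4 * p - 2 \<le> card M"
  shows "\<exists>I\<subseteq>M. card I = p \<and> int p dvd (\<Sum>i\<in>I. x i) \<and> int p dvd (\<Sum>i\<in>I. y i)"
proof -
  from zero_sum_of_length_plane[OF assms, of "\<lambda>i j. if j = 0 then x i else y i"]
  obtain I where I: "I \<subseteq> M" "card I = p" "\<forall>j<2::nat. int p dvd (\<Sum>i\<in>I. if j = 0 then x i else y i)"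
    by (elim exE conjE) (rule that)
  then show ?thesis
    using I(3)[rule_format, of 0] I(3)[rule_format, of 1] by auto
qed

text \<open>
  Terms in one affine plane behave like vectors of \<open>C\<^sub>p\<^sup>2\<close>: if two coordinates determine the third up
  to a constant, then \<open>p\<close> terms for which these two coordinates sum to zero form a zero sum,
  because the constant is added \<open>p\<close> times. More than \<open>4p\<close> terms would contain such \<open>p\<close> terms.
\<close>
lemma plane_sparse_of_no_short_zero_sum:
  fixes a :: "nat \<Rightarrow> vec"
  assumes p: "prime p" "p \<noteq> 2" and M: "finite M"
    and none: "\<And>I. I \<subseteq> M \<Longrightarrow> card I = p \<Longrightarrow> reduce p (\<Sum>i\<in>I. a i) \<noteq> 0"
  shows "plane_sparse p a M"
  unfolding plane_sparse_def
proof (intro allI impI, rule ccontr)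
  fix v \<delta> assume v: "reduce p v \<noteq> 0" and big: "\<not> card {i\<in>M. int p dvd dot v (a i) - \<delta>} \<le> 4 * p"
  define S where "S = {i\<in>M. int p dvd dot v (a i) - \<delta>}"
  have S: "finite S" "4 * p - 2 \<le> card S"
    using M big by (auto simp: S_def)
  obtain v1 v2 v3 where v123: "v = (v1, v2, v3)"
    by (cases v)
  define x y z where "x i = fst (a i)" and "y i = fst (snd (a i))" and "z i = snd (snd (a i))" for i
  have a: "a i = (x i, y i, z i)" for i
    by (simp add: x_def y_def z_def)
  have pr: "prime (int p)"
    using p by simp
  have no: False if I: "I \<subseteq> S" "card I = p" "int p dvd (\<Sum>i\<in>I. x i)" "int p dvd (\<Sum>i\<in>I. y i)"
    "int p dvd (\<Sum>i\<in>I. z i)" for I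
  proof -
    have "reduce p (\<Sum>i\<in>I. a i) = 0"
      using I(3-5) by (simp add: a sum_triple reduce_eq_0_iff del: reduce.simps)
    then show False
      using none[of I] I(1,2) by (auto simp: S_def)
  qed
  have lin: "int p dvd v1 * (\<Sum>i\<in>I. x i) + v2 * (\<Sum>i\<in>I. y i) + v3 * (\<Sum>i\<in>I. z i)"
    if I: "I \<subseteq> S" "card I = p" for I
  proof -
    have "int p dvd (\<Sum>i\<in>I. dot v (a i) - \<delta>)"
      using I(1) by (intro dvd_sum) (auto simp: S_def)
    also have "(\<Sum>i\<in>I. dot v (a i) - \<delta>)
        = (v1 * (\<Sum>i\<in>I. x i) + v2 * (\<Sum>i\<in>I. y i) + v3 * (\<Sum>i\<in>I. z i)) - int p * \<delta>"
      using I(2) by (simp add: a v123 sum.distrib sum_subtractf sum_distrib_left)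
    finally have "int p dvd (v1 * (\<Sum>i\<in>I. x i) + v2 * (\<Sum>i\<in>I. y i) + v3 * (\<Sum>i\<in>I. z i)) - int p * \<delta> + int p * \<delta>"
      by (intro dvd_add) auto
    then show ?thesis
      by simp
  qed
  consider "\<not> int p dvd v1" | "\<not> int p dvd v2" | "\<not> int p dvd v3"
    using v by (auto simp: v123 reduce_eq_0_iff simp del: reduce.simps)
  then show False
  proof cases
    case 1
    obtain I where I: "I \<subseteq> S" "card I = p" "int p dvd (\<Sum>i\<in>I. y i)" "int p dvd (\<Sum>i\<in>I. z i)"
      using zero_sum_of_length_pair[OF p S] by blast
    have "int p dvd v1 * (\<Sum>i\<in>I. x i)"
      using lin[OF I(1,2)] I(3,4) by (simp add: dvd_add_left_iff)
    then show False
      using no I 1 prime_dvd_multD[OF pr] by blast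
  next
    case 2
    obtain I where I: "I \<subseteq> S" "card I = p" "int p dvd (\<Sum>i\<in>I. x i)" "int p dvd (\<Sum>i\<in>I. z i)"
      using zero_sum_of_length_pair[OF p S] by blast
    have "int p dvd v2 * (\<Sum>i\<in>I. y i)"
      using lin[OF I(1,2)] I(3,4) by (simp add: dvd_add_left_iff dvd_add_right_iff)
    then show False
      using no I 2 prime_dvd_multD[OF pr] by blast
  next
    case 3
    obtain I where I: "I \<subseteq> S" "card I = p" "int p dvd (\<Sum>i\<in>I. x i)" "int p dvd (\<Sum>i\<in>I. y i)"
      using zero_sum_of_length_pair[OF p S] by blast
    have "int p dvd v3 * (\<Sum>i\<in>I. z i)"
      using lin[OF I(1,2)] I(3,4) by (simp add: dvd_add_right_iff)
    then show False
      using no I 3 prime_dvd_multD[OF pr] by blast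
  qed
qed

lemma short_zero_sum_large_prime:
  assumes p: "prime p" "6788 < p"
  shows "short_zero_sum_bound 3 p (20369 * (p - 1) + 1)"
  unfolding short_zero_sum_bound_def
proof (intro allI impI, elim conjE, rule ccontr)
  fix M :: "nat set" and a :: "nat \<Rightarrow> nat \<Rightarrow> int"
  assume M: "finite M" "20369 * (p - 1) + 1 \<le> card M"
  assume contra: "\<not> (\<exists>I\<subseteq>M. I \<noteq> {} \<and> card I \<le> p \<and> (\<forall>j<3. int p dvd (\<Sum>i\<in>I. a i j)))"
  define v where "v i = (a i 0, a i 1, a i 2)" for i
  have none: "reduce p (\<Sum>i\<in>I. v i) \<noteq> 0" if "I \<subseteq> M" "I \<noteq> {}" "card I \<le> p" for I
  proof -
    have "\<not> (\<forall>j<3. int p dvd (\<Sum>i\<in>I. a i j))"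
      using contra that by blast
    then show ?thesis
      unfolding v_def sum_triple reduce_eq_0_iff all_less_three .
  qed
  have "plane_sparse p v M"
  proof (rule plane_sparse_of_no_short_zero_sum[OF p(1) _ M(1)])
    fix I assume I: "I \<subseteq> M" "card I = p"
    then have "I \<noteq> {}"
      using p(2) by auto
    then show "reduce p (\<Sum>i\<in>I. v i) \<noteq> 0"
      using none[of I] I by blast
  qed (use p(2) in simp)
  moreover have "18000 * p \<le> card M"
    using M(2) p(2) by linarith
  ultimately show False
    using exists_short_zero_sum_of_plane_sparse[OF p M(1)] none by blast
qed

lemma short_zero_sum_rank_three:
  assumes "n > 0"
  shows "short_zero_sum_bound 3 n (20369 * (n - 1) + 1)"
proof (rule short_zero_sum_bound_from_primes[OF _ assms])
  fix p :: nat assume "prime p"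
  then show "short_zero_sum_bound 3 p (20369 * (p - 1) + 1)"
    using short_zero_sum_small_prime[of p 20369] short_zero_sum_large_prime[of p]
    by (cases "6788 < p") auto
qed

section \<open>The Davenport constant\<close>

lemma (in comm_group) seq_sum_add_mset:
  assumes "set_mset S \<subseteq> carrier G" "x \<in> carrier G"
  shows "seq_sum G (add_mset x S) = x \<otimes> seq_sum G S"
proof -
  let ?A = "set_mset (add_mset x S)"
  have carrier: "g \<in> carrier G" if "g \<in> ?A" for g
    using assms that by auto
  have "seq_sum G S = (\<Otimes>g\<in>?A. g [^] count S g)"
    unfolding seq_sum_def
    by (rule finprod_mono_neutral_cong_left) (use carrier in \<open>auto simp: not_in_iff\<close>)
  moreover have "(\<Otimes>g\<in>?A. if g = x then g else \<one>) = x"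
    by (rule finprod_singleton_swap) (use carrier in auto)
  moreover have "seq_sum G (add_mset x S) = (\<Otimes>g\<in>?A. (if g = x then g else \<one>) \<otimes> g [^] count S g)"
    unfolding seq_sum_def
    by (rule finprod_cong') (use carrier assms(2) in \<open>auto simp: m_comm\<close>)
  moreover have "(\<Otimes>g\<in>?A. (if g = x then g else \<one>) \<otimes> g [^] count S g)
      = (\<Otimes>g\<in>?A. if g = x then g else \<one>) \<otimes> (\<Otimes>g\<in>?A. g [^] count S g)"
    by (rule finprod_multf) (use carrier in auto)
  ultimately show ?thesis
    by simp
qed

lemma (in comm_group) seq_sum_image_mset:
  assumes "finite I" "f ` I \<subseteq> carrier G"
  shows "seq_sum G (image_mset f (mset_set I)) = finprod G f I"
  using assms
proof (induction I rule: finite_induct)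
  case empty
  then show ?case
    by (simp add: seq_sum_def)
next
  case (insert i I)
  then show ?case
    by (subst finprod_insert) (auto simp: seq_sum_add_mset)
qed

text \<open>
  Passes from multisets to indexed families, so that subsequences become subsets of the index set.
\<close>
lemma davenport_le:
  assumes G: "comm_group G"
    and zs: "\<And>f M :: nat set. finite M \<Longrightarrow> t \<le> card M \<Longrightarrow> f ` M \<subseteq> carrier G \<Longrightarrow>
      \<exists>I\<subseteq>M. I \<noteq> {} \<and> finprod G f I = \<one>\<^bsub>G\<^esub>"
  shows "davenport G \<le> t"
  unfolding davenport_def
proof (rule Least_le, intro allI impI, elim conjE)
  fix S assume S: "set_mset S \<subseteq> carrier G" "t \<le> size S"
  obtain xs where xs: "mset xs = S"
    using ex_mset by blast
  define M where "M = {..<length xs}"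
  have S_eq: "S = image_mset (\<lambda>i. xs ! i) (mset_set M)"
    unfolding xs[symmetric] M_def using map_nth[of xs]
    by (metis atLeast0LessThan mset_map mset_upt)
  have carrier: "(\<lambda>i. xs ! i) ` M \<subseteq> carrier G"
    using S(1) xs by (auto simp: M_def)
  have "finite M" "t \<le> card M"
    using S(2) xs by (auto simp: M_def)
  then obtain I where I: "I \<subseteq> M" "I \<noteq> {}" "finprod G (\<lambda>i. xs ! i) I = \<one>\<^bsub>G\<^esub>"
    using zs[OF _ _ carrier] by blast
  have finI: "finite I"
    using finite_subset[OF I(1)] by (simp add: M_def)
  define T where "T = image_mset (\<lambda>i. xs ! i) (mset_set I)"
  have "T \<subseteq># S"
    unfolding T_def S_eq using I(1) by (intro image_mset_subseteq_mono) (simp add: M_def subset_imp_msubset_mset_set)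
  moreover have "T \<noteq> {#}"
    using I(2) finI by (simp add: T_def mset_set_empty_iff)
  moreover have "zero_sum G T"
    unfolding zero_sum_def T_def
    using comm_group.seq_sum_image_mset[OF G finI, of "\<lambda>i. xs ! i"] carrier I(1,3) by auto
  ultimately show "\<exists>T. T \<subseteq># S \<and> T \<noteq> {#} \<and> zero_sum G T"
    by blast
qed

lemma comm_group_DirProd:
  assumes "comm_group G" "comm_group H"
  shows "comm_group (G \<times>\<times> H)"
proof -
  interpret G: comm_group G by fact
  interpret H: comm_group H by fact
  show ?thesis
    by (rule group.group_comm_groupI[OF DirProd_group[OF G.is_group H.is_group]])
      (auto simp: G.m_comm H.m_comm)
qed

lemma finprod_integer_mod_groups:
  fixes f :: "nat \<Rightarrow> int \<times> int \<times> int" and n1 n2 n3 :: nat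
  defines "G \<equiv> integer_mod_group n1 \<times>\<times> integer_mod_group n2 \<times>\<times> integer_mod_group n3"
  assumes "finite I" "f ` I \<subseteq> carrier G"
  shows "finprod G f I = ((\<Sum>i\<in>I. fst (f i)) mod int n1, (\<Sum>i\<in>I. fst (snd (f i))) mod int n2,
    (\<Sum>i\<in>I. snd (snd (f i))) mod int n3)"
proof -
  interpret comm_group G
    unfolding G_def by (intro comm_group_DirProd abelian_integer_mod_group)
  show ?thesis
    using assms(2,3)
  proof (induction I rule: finite_induct)
    case empty
    have "\<one>\<^bsub>G\<^esub> = (0, 0, 0)"
      by (simp add: G_def)
    then show ?case
      by simp
  next
    case (insert i I)
    then show ?case
      by (subst finprod_insert) (auto simp: G_def mult_DirProd' mod_simps)
  qed
qed

lemma davenport_rank_three_le: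
  assumes "n1 > 0" "n2 > 0" "n3 > 0" "n1 dvd n2" "n2 dvd n3"
  shows "davenport (integer_mod_group n1 \<times>\<times> integer_mod_group n2 \<times>\<times> integer_mod_group n3)
    \<le> 20369 * (n1 - 1) + 1 + n2 + n3 - 2 * n1"
proof (rule davenport_le)
  show "comm_group (integer_mod_group n1 \<times>\<times> integer_mod_group n2 \<times>\<times> integer_mod_group n3)"
    by (intro comm_group_DirProd abelian_integer_mod_group)
next
  fix f :: "nat \<Rightarrow> int \<times> int \<times> int" and M :: "nat set"
  assume M: "finite M" "20369 * (n1 - 1) + 1 + n2 + n3 - 2 * n1 \<le> card M"
    and f: "f ` M \<subseteq> carrier (integer_mod_group n1 \<times>\<times> integer_mod_group n2 \<times>\<times> integer_mod_group n3)"
  define a where "a i j = (if j = 0 then fst (f i) else if j = 1 then fst (snd (f i)) else snd (snd (f i)))"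
    for i j :: nat
  have "20369 * (n1 - 1) + 1 + n2 + n3 \<le> card M + 2 * n1"
    using M(2) by linarith
  then obtain I where I: "I \<subseteq> M" "I \<noteq> {}" "int n1 dvd (\<Sum>i\<in>I. a i 0)" "int n2 dvd (\<Sum>i\<in>I. a i 1)"
      "int n3 dvd (\<Sum>i\<in>I. a i 2)"
    using zero_sum_rank_three[OF short_zero_sum_rank_three[OF assms(1)] assms(4,5,1,2,3) M(1), of a] by blast
  have "finprod (integer_mod_group n1 \<times>\<times> integer_mod_group n2 \<times>\<times> integer_mod_group n3) f I
      = \<one>\<^bsub>integer_mod_group n1 \<times>\<times> integer_mod_group n2 \<times>\<times> integer_mod_group n3\<^esub>"
    using I(3-5) f I(1) finite_subset[OF I(1) M(1)]
    by (subst finprod_integer_mod_groups) (auto simp: a_def dvd_eq_mod_eq_0)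
  then show "\<exists>I\<subseteq>M. I \<noteq> {} \<and> finprod (integer_mod_group n1 \<times>\<times> integer_mod_group n2 \<times>\<times> integer_mod_group n3) f I
      = \<one>\<^bsub>integer_mod_group n1 \<times>\<times> integer_mod_group n2 \<times>\<times> integer_mod_group n3\<^esub>"
    using I(1,2) by blast
qed

theorem theorem3p9:
  shows "\<exists>a\<^sub>3::real. a\<^sub>3 \<le> 20369 \<and>
    (\<forall>n\<^sub>1 n\<^sub>2 n\<^sub>3 :: nat.
       1 < n\<^sub>1 \<and> 0 < n\<^sub>2 \<and> 0 < n\<^sub>3 \<and> n\<^sub>1 dvd n\<^sub>2 \<and> n\<^sub>2 dvd n\<^sub>3 \<longrightarrow>
       real (davenport (integer_mod_group n\<^sub>1 \<times>\<times> integer_mod_group n\<^sub>2 \<times>\<times> integer_mod_group n\<^sub>3))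
         \<le> (real n\<^sub>1 - 1) + (real n\<^sub>2 - 1) + (real n\<^sub>3 - 1) + 1 + (a\<^sub>3 - 3) * (real n\<^sub>1 - 1))"
proof (intro exI[of _ 20369] conjI allI impI, simp, elim conjE)
  fix n1 n2 n3 :: nat
  assume n: "1 < n1" "0 < n2" "0 < n3" "n1 dvd n2" "n2 dvd n3"
  let ?D = "davenport (integer_mod_group n1 \<times>\<times> integer_mod_group n2 \<times>\<times> integer_mod_group n3)"
  have "?D \<le> 20369 * (n1 - 1) + 1 + n2 + n3 - 2 * n1"
    using n by (intro davenport_rank_three_le) auto
  moreover have "n1 \<le> n2" "n2 \<le> n3"
    using n by (auto intro: dvd_imp_le)
  ultimately have "?D + 2 * n1 + 20369 \<le> 20369 * n1 + 1 + n2 + n3"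
    using n(1) by linarith
  then show "real ?D \<le> (real n1 - 1) + (real n2 - 1) + (real n3 - 1) + 1 + (20369 - 3) * (real n1 - 1)"
    by (simp add: algebra_simps)
qed

end
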